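(* Let $0\leq\alpha\leq\rho$, $\rho>0$, $0<\gamma<\sigma\leq 1$, $\delta\in\{-1,1\}$, $0<p<1$ and $\frac1p+\frac1q=1$. Suppose there exists $n_0\in\mathbf N$ such that $\nu_n\geq\nu_{n+1}$ for all $n\in\{n_0,n_0+1,\dots\}$, and $U(\infty)=V(\infty)=\infty$. Then for all functions $f\ge 0$ on $\mathbf R_+$ and all sequences $a=\{a_n\}_{n=1}^\infty$, $a_n\ge0$, with $0<\|f\|_{p,\Phi_\delta}<\infty$ and $0<\|a\|_{q,\widetilde\Psi}<\infty$, the following equivalent inequalities hold: $$\sum_{n=1}^{\infty}\int_0^\infty H_\delta(x,n)\,a_nf(x)\,dx>k(\sigma)\|f\|_{p,\widetilde\Phi_\delta}\|a\|_{q,\widetilde\Psi},$$ $$\left\{\sum_{n=1}^\infty\frac{\nu_n}{\widetilde V_n^{1-p\sigma}}\left[\int_0^\infty H_\delta(x,n)f(x)\,dx\right]^p\right\}^{\frac1p}>k(\sigma)\|f\|_{p,\widetilde\Phi_\delta},$$ $$\left\{\int_0^\infty\frac{(1-\theta_\delta(\sigma,x))^{1-q}\mu(x)}{U^{1-q\delta\sigma}(x)}\left[\sum_{n=1}^\infty H_\delta(x,n)a_n\right]^q dx\right\}^{\frac1q}>k(\sigma)\|a\|_{q,\widetilde\Psi}.$$ Moreover the constant factor $k(\sigma)$ is the best possible in each of them, i.e. it cannot be replaced by any larger constant so that the inequality remains valid for all such $f$ and $a$.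
   Context: $\mathbf{N}=\{1,2,\dots\}$, $\mathbf{R}_+=(0,\infty)$. $\nu_n>0$ ($n\in\mathbf N$) are given reals, $V_n:=\sum_{j=1}^n\nu_j$, $\widetilde\nu_n\in[0,\frac{\nu_n}{2}]$, $\widetilde V_n:=V_n-\widetilde\nu_n$. $\mu$ is a positive continuous function on $\mathbf R_+$ with $U(x):=\int_0^x\mu(t)\,dt<\infty$ for $x\in[0,\infty)$, and $U(\infty):=\int_0^\infty\mu(t)\,dt$. $\nu(t):=\nu_n$ for $t\in(n-\frac12,n+\frac12]$, $V(y):=\int_{1/2}^y\nu(t)\,dt$ for $y\ge\frac12$, and $V(\infty):=\lim_{y\to\infty}V(y)=\sum_{n=1}^\infty\nu_n$. Powers such as $U^{s}(x)$ mean $(U(x))^{s}$. Functions are assumed measurable. $\operatorname{csch}(u):=\frac{2}{e^u-e^{-u}}$ for $u>0$. The kernel is $$H_\delta(x,n):=\frac{\operatorname{csch}\big(\rho(U^\delta(x)\widetilde V_n)^\gamma\big)}{e^{\alpha(U^\delta(x)\widetilde V_n)^\gamma}}.$$ $$k(\sigma):=\int_0^\infty\frac{\operatorname{csch}(\rho t^\gamma)}{e^{\alpha t^\gamma}}t^{\sigma-1}dt=\frac{2\Gamma(\frac\sigma\gamma)}{\gamma(2\rho)^{\sigma/\gamma}}\zeta\Big(\frac\sigma\gamma,\frac{\alpha+\rho}{2\rho}\Big),$$ where $\zeta(s,a):=\sum_{k=0}^\infty\frac1{(k+a)^s}$ ($s>1$, $0<a\le1$) is the Hurwitz zeta function and $\Gamma$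 is the Gamma function. $$\theta_\delta(\sigma,x):=\frac{1}{k(\sigma)}\int_0^{U^\delta(x)V_{n_0}}\frac{\operatorname{csch}(\rho u^\gamma)}{e^{\alpha u^\gamma}}u^{\sigma-1}du\in(0,1)\qquad(x\in\mathbf R_+).$$ $\Phi_\delta(x):=\frac{U^{p(1-\delta\sigma)-1}(x)}{\mu^{p-1}(x)}$, $\widetilde\Phi_\delta(x):=(1-\theta_\delta(\sigma,x))\Phi_\delta(x)$, $\widetilde\Psi(n):=\frac{\widetilde V_n^{q(1-\sigma)-1}}{\nu_n^{q-1}}$; the formal symbols $\|f\|_{p,\Phi}:=\left(\int_0^\infty\Phi(x)f^p(x)\,dx\right)^{1/p}$ (for $\Phi=\Phi_\delta$ or $\widetilde\Phi_\delta$), $\|a\|_{q,\widetilde\Psi}:=\left(\sum_{n=1}^\infty\widetilde\Psi(n)a_n^q\right)^{1/q}$ are used also for exponents less than $1$ (they are then not norms), with the extended-real conventions $0^r=\infty$, $\infty^r=0$ for $r<0$. *)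

theory Defs
  imports "HOL-Analysis.Analysis"
begin

text \<open>Sequences indexed by the positive integers are functions on \<^typ>\<open>nat\<close> whose value at 0 is
  never used; sums over the positive integers are written with \<^term>\<open>Suc n\<close>.
  Integrals and series of nonnegative terms take values in \<^typ>\<open>ennreal\<close>, so they always exist
  and may be infinite.\<close>

text \<open>Real powers of extended nonnegative reals. For a negative exponent, 0 is sent to
  \<open>\<infinity>\<close> and \<open>\<infinity>\<close> to 0 (whereas \<open>powr\<close> on the reals sends 0 to 0).\<close>

definition epow :: "ennreal \<Rightarrow> real \<Rightarrow> ennreal" where
  "epow x r =
     (if r = 0 then 1
      else if x = 0 then (if r < 0 then \<infinity> else 0)
      else if x = \<infinity> then (if r < 0 then 0 else \<infinity>)
      else ennreal (enn2real x powr r))"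

definition csch :: "real \<Rightarrow> real" where
  "csch u = 2 / (exp u - exp (- u))"

definition kern :: "real \<Rightarrow> real \<Rightarrow> real \<Rightarrow> real \<Rightarrow> real" where
  "kern \<alpha> \<rho> \<gamma> t = csch (\<rho> * t powr \<gamma>) / exp (\<alpha> * t powr \<gamma>)"

definition U :: "(real \<Rightarrow> real) \<Rightarrow> real \<Rightarrow> real" where
  "U \<mu> x = (LBINT t:{0<..x}. \<mu> t)"

definition U_infinity :: "(real \<Rightarrow> real) \<Rightarrow> ennreal" where
  "U_infinity \<mu> = (\<integral>\<^sup>+t\<in>{0<..}. ennreal (\<mu> t) \<partial>lborel)"

definition V :: "(nat \<Rightarrow> real) \<Rightarrow> nat \<Rightarrow> real" where
  "V \<nu> n = (\<Sum>j=1..n. \<nu> j)"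

definition V_infinity :: "(nat \<Rightarrow> real) \<Rightarrow> ennreal" where
  "V_infinity \<nu> = (\<Sum>n. ennreal (\<nu> (Suc n)))"

text \<open>The second argument of \<open>Vt\<close> is the sequence \<open>\<nu>\<close> with a tilde.\<close>

definition Vt :: "(nat \<Rightarrow> real) \<Rightarrow> (nat \<Rightarrow> real) \<Rightarrow> nat \<Rightarrow> real" where
  "Vt \<nu> \<nu>t n = V \<nu> n - \<nu>t n"

definition H :: "real \<Rightarrow> real \<Rightarrow> real \<Rightarrow> real \<Rightarrow> (real \<Rightarrow> real) \<Rightarrow> (nat \<Rightarrow> real) \<Rightarrow> (nat \<Rightarrow> real)
    \<Rightarrow> real \<Rightarrow> nat \<Rightarrow> real" where
  "H \<alpha> \<rho> \<gamma> \<delta> \<mu> \<nu> \<nu>t x n = kern \<alpha> \<rho> \<gamma> (U \<mu> x powr \<delta> * Vt \<nu> \<nu>t n)"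

definition k :: "real \<Rightarrow> real \<Rightarrow> real \<Rightarrow> real \<Rightarrow> real" where
  "k \<alpha> \<rho> \<gamma> \<sigma> = (LBINT t:{0<..}. kern \<alpha> \<rho> \<gamma> t * t powr (\<sigma> - 1))"

definition \<theta> :: "real \<Rightarrow> real \<Rightarrow> real \<Rightarrow> real \<Rightarrow> (real \<Rightarrow> real) \<Rightarrow> (nat \<Rightarrow> real) \<Rightarrow> nat
    \<Rightarrow> real \<Rightarrow> real \<Rightarrow> real" where
  "\<theta> \<alpha> \<rho> \<gamma> \<delta> \<mu> \<nu> n0 \<sigma> x =
     1 / k \<alpha> \<rho> \<gamma> \<sigma> *
     (LBINT u:{0<..U \<mu> x powr \<delta> * V \<nu> n0}. kern \<alpha> \<rho> \<gamma> u * u powr (\<sigma> - 1))"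

definition \<Phi> :: "real \<Rightarrow> (real \<Rightarrow> real) \<Rightarrow> real \<Rightarrow> real \<Rightarrow> real \<Rightarrow> real" where
  "\<Phi> \<delta> \<mu> \<sigma> p x = U \<mu> x powr (p * (1 - \<delta> * \<sigma>) - 1) / \<mu> x powr (p - 1)"

definition \<Phi>t :: "real \<Rightarrow> real \<Rightarrow> real \<Rightarrow> real \<Rightarrow> (real \<Rightarrow> real) \<Rightarrow> (nat \<Rightarrow> real) \<Rightarrow> nat
    \<Rightarrow> real \<Rightarrow> real \<Rightarrow> real \<Rightarrow> real" where
  "\<Phi>t \<alpha> \<rho> \<gamma> \<delta> \<mu> \<nu> n0 \<sigma> p x = (1 - \<theta> \<alpha> \<rho> \<gamma> \<delta> \<mu> \<nu> n0 \<sigma> x) * \<Phi> \<delta> \<mu> \<sigma> p x"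

definition \<Psi>t :: "(nat \<Rightarrow> real) \<Rightarrow> (nat \<Rightarrow> real) \<Rightarrow> real \<Rightarrow> real \<Rightarrow> nat \<Rightarrow> real" where
  "\<Psi>t \<nu> \<nu>t \<sigma> q n = Vt \<nu> \<nu>t n powr (q * (1 - \<sigma>) - 1) / \<nu> n powr (q - 1)"

definition fun_norm :: "real \<Rightarrow> (real \<Rightarrow> real) \<Rightarrow> (real \<Rightarrow> real) \<Rightarrow> ennreal" where
  "fun_norm p w f =
     epow (\<integral>\<^sup>+x. ennreal (w x) * epow (ennreal (f x)) p \<partial>lebesgue_on {0<..}) (1 / p)"

definition seq_norm :: "real \<Rightarrow> (nat \<Rightarrow> real) \<Rightarrow> (nat \<Rightarrow> real) \<Rightarrow> ennreal" where
  "seq_norm q w a =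
     epow (\<Sum>n. ennreal (w (Suc n)) * epow (ennreal (a (Suc n))) q) (1 / q)"

definition admissible :: "real \<Rightarrow> (real \<Rightarrow> real) \<Rightarrow> (nat \<Rightarrow> real) \<Rightarrow> (nat \<Rightarrow> real) \<Rightarrow> real \<Rightarrow> real \<Rightarrow> real
    \<Rightarrow> (real \<Rightarrow> real) \<Rightarrow> (nat \<Rightarrow> real) \<Rightarrow> bool" where
  "admissible \<delta> \<mu> \<nu> \<nu>t \<sigma> p q f a \<longleftrightarrow>
     f \<in> borel_measurable (lebesgue_on {0<..}) \<and> (\<forall>x>0. f x \<ge> 0) \<and> (\<forall>n\<ge>1. a n \<ge> 0) \<and>
     0 < fun_norm p (\<Phi> \<delta> \<mu> \<sigma> p) f \<and> fun_norm p (\<Phi> \<delta> \<mu> \<sigma> p) f < \<infinity> \<and>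
     0 < seq_norm q (\<Psi>t \<nu> \<nu>t \<sigma> q) a \<and> seq_norm q (\<Psi>t \<nu> \<nu>t \<sigma> q) a < \<infinity>"

text \<open>The left-hand sides of the three inequalities; \<open>h\<close> is the kernel \<open>H\<^sub>\<delta>(x, n)\<close> and
  \<open>th\<close> is the function \<open>x \<mapsto> \<theta>\<^sub>\<delta>(\<sigma>, x)\<close>.\<close>

definition lhs1 :: "(real \<Rightarrow> nat \<Rightarrow> real) \<Rightarrow> (real \<Rightarrow> real) \<Rightarrow> (nat \<Rightarrow> real) \<Rightarrow> ennreal" where
  "lhs1 h f a = (\<Sum>n. \<integral>\<^sup>+x. ennreal (h x (Suc n) * a (Suc n) * f x) \<partial>lebesgue_on {0<..})"

definition lhs2 :: "(real \<Rightarrow> nat \<Rightarrow> real) \<Rightarrow> (nat \<Rightarrow> real) \<Rightarrow> (nat \<Rightarrow> real) \<Rightarrow> real \<Rightarrow> real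
    \<Rightarrow> (real \<Rightarrow> real) \<Rightarrow> ennreal" where
  "lhs2 h \<nu> \<nu>t \<sigma> p f =
     epow (\<Sum>n. ennreal (\<nu> (Suc n) / Vt \<nu> \<nu>t (Suc n) powr (1 - p * \<sigma>)) *
       epow (\<integral>\<^sup>+x. ennreal (h x (Suc n) * f x) \<partial>lebesgue_on {0<..}) p) (1 / p)"

definition lhs3 :: "(real \<Rightarrow> nat \<Rightarrow> real) \<Rightarrow> (real \<Rightarrow> real) \<Rightarrow> (real \<Rightarrow> real) \<Rightarrow> real \<Rightarrow> real \<Rightarrow> real
    \<Rightarrow> (nat \<Rightarrow> real) \<Rightarrow> ennreal" where
  "lhs3 h th \<mu> \<delta> \<sigma> q a =
     epow (\<integral>\<^sup>+x. ennreal ((1 - th x) powr (1 - q) * \<mu> x / U \<mu> x powr (1 - q * \<delta> * \<sigma>)) *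
       epow (\<Sum>n. ennreal (h x (Suc n) * a (Suc n))) q \<partial>lebesgue_on {0<..}) (1 / q)"

end

theory Submission
  imports Defs
begin

text \<open>
  Write $H(x,n)$ for the kernel, $k$ for its Mellin transform and $q = p/(p-1) < 0$. Everything rests
  on two weights. Integrating in $x$, the substitution $t = U(x)^\<delta> \widetilde V_n$ gives the
  exact value
  $$\int_0^\infty H(x,n)\, U(x)^{\<delta>\<sigma>-1} \<mu>(x)\,dx = k(\<sigma>)\, \widetilde V_n^{-\<sigma>}$$
  (\<open>nn_integral_h_w\<close>). The sum in $n$ is compared with an integral over
  $(V_{n_0}, \<infinity>)$: as a function of $\widetilde V_n$ the summand divided by $\<nu>_n$ is
  strictly decreasing, and the $\<nu>_n$ do not increase from $n_0$ on. Thus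
  $$\sum_n \<nu>_n \widetilde V_n^{\<sigma>-1} H(x,n) > k(\<sigma>)\,(1 - \<theta>(x))\, U(x)^{-\<delta>\<sigma>}$$
  (\<open>weight_greater\<close>).

  For $0 < p < 1$ the ordinary Hoelder inequality
  $\int A^p B^{1-p} \<le> (\int A)^p (\int B)^{1-p}$ acts as a reverse inequality: when $\int B$ and
  the left-hand side are known, it bounds $\int A$ from below. Applied in $x$ for each $n$, and then
  summed with the second weight, it gives the second inequality (\<open>lhs2_greater\<close>). Applied in $n$
  for each $x$, and then integrated with the first weight, it gives the third (\<open>lhs3_greater\<close>).
  One more application shows that the left-hand side of the first inequality is at least the
  second left-hand side times the norm of $a$ (\<open>lhs1_ge_lhs2\<close>), and at least the third one times
  the norm of $f$ (\<open>lhs1_ge_lhs3\<close>). Hence the first inequality follows from the second, and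
  a constant that is valid in the second or in the third inequality is valid in the first. All
  integrals and series are extended nonnegative numbers, and this step has to cope with series
  that diverge at some points.

  It is therefore enough to see that $k(\<sigma>)$ is optimal in the first inequality. Take
  $f = U^{\<delta>(\<sigma>+e/p)-1} \<mu>$ on $\{U^\<delta> \<le> 1\}$ and
  $a_n = \widetilde V_n^{\<sigma>-e/q-1} \<nu>_n$. Since the integral in $x$ is exact, the
  left-hand side is at most $k(\<sigma>+e/p)\, S$ with $S = \sum_n \<nu>_n \widetilde V_n^{-1-e}$,
  which is also the series in the norm of $a$. Here $e S$ is bounded above, and $e$ times the integral
  in the norm of $f$ is bounded below, by quantities that tend to $1$ with $e \<rightarrow> 0$. Together with
  the continuity of $k$ this excludes every larger constant (\<open>best_constant\<close>).
\<close>

section \<open>Extended powers and the Hoelder inequality\<close>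

lemma epow_ennreal: "x > 0 \<Longrightarrow> epow (ennreal x) r = ennreal (x powr r)"
  by (auto simp: epow_def)

lemma epow_ennreal': "x \<ge> 0 \<Longrightarrow> r > 0 \<Longrightarrow> epow (ennreal x) r = ennreal (x powr r)"
  by (cases "x = 0") (auto simp: epow_ennreal, simp add: epow_def)

lemma epow_0 [simp]: "r > 0 \<Longrightarrow> epow 0 r = 0"
  by (auto simp: epow_def)

lemma epow_top [simp]: "r > 0 \<Longrightarrow> epow top r = top"
  by (auto simp: epow_def)

lemma epow_0_neg [simp]: "r < 0 \<Longrightarrow> epow 0 r = top"
  by (auto simp: epow_def)

lemma epow_top_neg [simp]: "r < 0 \<Longrightarrow> epow top r = 0"
  by (auto simp: epow_def)

lemma epow_one [simp]: "epow x 1 = x"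
  by (cases x) (auto simp: epow_def)

lemma epow_finite_pos_cases [case_names zero top real]:
  assumes "x = 0 \<Longrightarrow> P" "x = top \<Longrightarrow> P" "\<And>r. r > 0 \<Longrightarrow> x = ennreal r \<Longrightarrow> P"
  shows P
proof (cases x)
  case (real r)
  show P
  proof (cases "r = 0")
    case True
    with real show P by (intro assms(1)) simp
  next
    case False
    with real show P by (intro assms(3)[of r]) simp_all
  qed
qed (rule assms(2))

text \<open>The exponents multiply without any sign condition: at $0$ and $\<infinity>$ the value
  depends only on the sign of the exponent, and signs multiply in the same way.\<close>

lemma epow_epow: "epow (epow x r) s = epow x (r * s)"
proof (cases x rule: epow_finite_pos_cases)
  case zero
  then show ?thesis
    by (cases r "0::real" rule: linorder_cases; cases s "0::real" rule: linorder_cases)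
      (auto simp: epow_def mult_less_0_iff)
next
  case top
  then show ?thesis
    by (cases r "0::real" rule: linorder_cases; cases s "0::real" rule: linorder_cases)
      (auto simp: epow_def mult_less_0_iff)
next
  case (real a)
  then show ?thesis by (simp add: epow_ennreal powr_powr)
qed

lemma epow_mult:
  assumes "r > 0"
  shows "epow (x * y) r = epow x r * epow y r"
proof (cases x rule: epow_finite_pos_cases)
  case zero then show ?thesis using assms by simp
next
  case top then show ?thesis using assms
    by (cases y rule: epow_finite_pos_cases) (auto simp: ennreal_top_mult epow_ennreal)
next
  case (real a)
  note a = this
  show ?thesis
  proof (cases y rule: epow_finite_pos_cases)
    case zero then show ?thesis using assms by simp
  next
    case top then show ?thesis using assms a by (auto simp: ennreal_mult_top epow_ennreal)
  next
    case (real b)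
    then show ?thesis using a
      by (simp add: epow_ennreal powr_mult flip: ennreal_mult')
  qed
qed

text \<open>A positive finite factor can be taken out of a power of either sign; for two arbitrary
  factors and a negative exponent the product $0 \<cdot> \<infinity>$ would be an obstruction.\<close>

lemma epow_mult_real:
  assumes "a > 0"
  shows "epow (ennreal a * y) r = ennreal (a powr r) * epow y r"
proof (cases y rule: epow_finite_pos_cases)
  case zero then show ?thesis using assms
    by (cases r "0::real" rule: linorder_cases) (auto simp: epow_def ennreal_mult_top)
next
  case top then show ?thesis using assms
    by (cases r "0::real" rule: linorder_cases) (auto simp: epow_def ennreal_mult_top)
next
  case (real b)
  then show ?thesis using assms
    by (simp add: epow_ennreal powr_mult flip: ennreal_mult')
qed

lemma epow_strict_mono:
  assumes "r > 0" "x < y"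
  shows "epow x r < epow y r"
proof (cases x rule: epow_finite_pos_cases)
  case zero
  then show ?thesis using assms
    by (cases y rule: epow_finite_pos_cases) (auto simp: epow_ennreal)
next
  case top then show ?thesis using assms by simp
next
  case (real a)
  then show ?thesis using assms
    by (cases y rule: epow_finite_pos_cases) (auto simp: epow_ennreal ennreal_less_iff intro!: powr_less_mono2)
qed

lemma epow_mono: "r > 0 \<Longrightarrow> x \<le> y \<Longrightarrow> epow x r \<le> epow y r"
  using epow_strict_mono[of r x y] by (auto simp: le_less)

lemma epow_strict_antimono:
  assumes "r < 0" "x < y"
  shows "epow y r < epow x r"
proof (cases x rule: epow_finite_pos_cases)
  case zero
  then show ?thesis using assms
    by (cases y rule: epow_finite_pos_cases) (auto simp: epow_ennreal)
next
  case top then show ?thesis using assms by simp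
next
  case (real a)
  then show ?thesis using assms
    by (cases y rule: epow_finite_pos_cases) (auto simp: epow_ennreal ennreal_less_iff powr_less_mono2_neg)
qed

lemma epow_pos_finite_iff:
  assumes "r \<noteq> 0"
  shows "0 < epow x r \<and> epow x r < top \<longleftrightarrow> 0 < x \<and> x < top"
proof (cases x rule: epow_finite_pos_cases)
  case zero
  then show ?thesis using assms by (cases "r < 0") auto
next
  case top
  then show ?thesis using assms by (cases "r < 0") auto
next
  case (real a)
  then show ?thesis by (simp add: epow_ennreal)
qed

lemma borel_measurable_epow [measurable]:
  assumes [measurable]: "f \<in> borel_measurable M"
  shows "(\<lambda>x. epow (f x) r) \<in> borel_measurable M"
proof -
  have "{x \<in> space M. f x = 0} \<in> sets M" "{x \<in> space M. f x = \<infinity>} \<in> sets M"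
    by measurable
  moreover have "(\<lambda>x. ennreal (enn2real (f x) powr r)) \<in> borel_measurable M"
    by measurable
  ultimately show ?thesis
    unfolding epow_def by (intro measurable_If borel_measurable_const) auto
qed

lemma epow_weighted_am_gm:
  assumes "0 < s" "s < 1"
  shows "epow x s * epow y (1 - s) \<le> ennreal s * x + ennreal (1 - s) * y"
proof (cases x rule: epow_finite_pos_cases)
  case zero then show ?thesis using assms by simp
next
  case top then show ?thesis using assms by (simp add: ennreal_mult_top)
next
  case (real a)
  note a = this
  show ?thesis
  proof (cases y rule: epow_finite_pos_cases)
    case zero then show ?thesis using assms by simp
  next
    case top then show ?thesis using assms by (simp add: ennreal_mult_top)
  next
    case (real b)
    then show ?thesis using a assms Youngs_inequality_0[of s "1 - s" a b]
      by (simp add: epow_ennreal flip: ennreal_mult' ennreal_plus)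
  qed
qed

text \<open>The inequality is used throughout with $s = p$. Choosing $A$ and $B$ so that the left-hand
  side is a known integral turns it into the reverse Hoelder inequality for the exponents $p$ and
  $q$: it bounds the integral of $A$ from below.\<close>

lemma nn_integral_Holder:
  assumes s: "0 < s" "s < 1"
    and [measurable]: "A \<in> borel_measurable M" "B \<in> borel_measurable M"
  shows "(\<integral>\<^sup>+x. epow (A x) s * epow (B x) (1 - s) \<partial>M)
       \<le> epow (\<integral>\<^sup>+x. A x \<partial>M) s * epow (\<integral>\<^sup>+x. B x \<partial>M) (1 - s)"
proof -
  let ?a = "\<integral>\<^sup>+x. A x \<partial>M" and ?b = "\<integral>\<^sup>+x. B x \<partial>M"
  consider (a0) "?a = 0" | (b0) "?b = 0" | (inf) "?a \<noteq> 0" "?b \<noteq> 0" "?a = top \<or> ?b = top"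
    | (fin) "?a \<noteq> 0" "?b \<noteq> 0" "?a \<noteq> top" "?b \<noteq> top"
    by blast
  then show ?thesis
  proof cases
    case a0
    then have "AE x in M. A x = 0" by (simp add: nn_integral_0_iff_AE)
    then have "(\<integral>\<^sup>+x. epow (A x) s * epow (B x) (1 - s) \<partial>M) = (\<integral>\<^sup>+x. 0 \<partial>M)"
      by (intro nn_integral_cong_AE) (auto elim!: eventually_mono simp: s)
    then show ?thesis by simp
  next
    case b0
    then have "AE x in M. B x = 0" by (simp add: nn_integral_0_iff_AE)
    then have "(\<integral>\<^sup>+x. epow (A x) s * epow (B x) (1 - s) \<partial>M) = (\<integral>\<^sup>+x. 0 \<partial>M)"
      by (intro nn_integral_cong_AE) (auto elim!: eventually_mono simp: s)
    then show ?thesis by simp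
  next
    case inf
    have "epow ?a s \<noteq> 0" "epow ?b (1 - s) \<noteq> 0"
      using epow_strict_mono[of s 0 ?a] epow_strict_mono[of "1 - s" 0 ?b] inf s
      by (auto simp: zero_less_iff_neq_zero)
    then have "epow ?a s * epow ?b (1 - s) = top"
      using inf(3) s by (auto simp: ennreal_top_mult ennreal_mult_top)
    then show ?thesis by simp
  next
    case fin
    define a b where "a = enn2real ?a" and "b = enn2real ?b"
    have ab: "a > 0" "b > 0" "?a = ennreal a" "?b = ennreal b"
      using fin by (simp_all add: a_def b_def enn2real_positive_iff less_top zero_less_iff_neq_zero)
    let ?c = "ennreal (a powr s * b powr (1 - s))"
    \<comment> \<open>normalise both functions to integral 1 and integrate the pointwise inequality\<close>
    have "epow (A x) s * epow (B x) (1 - s)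
        \<le> ?c * (ennreal (s / a) * A x + ennreal ((1 - s) / b) * B x)" for x
    proof -
      have A: "A x = ennreal a * (ennreal (1 / a) * A x)" and B: "B x = ennreal b * (ennreal (1 / b) * B x)"
        using ab by (simp_all add: mult.assoc[symmetric] flip: ennreal_mult')
      have "epow (A x) s * epow (B x) (1 - s) =
          ennreal (a powr s) * epow (ennreal (1 / a) * A x) s *
          (ennreal (b powr (1 - s)) * epow (ennreal (1 / b) * B x) (1 - s))"
        by (subst A, subst B, subst (1 2) epow_mult_real) (use ab in auto)
      also have "\<dots> = ?c * (epow (ennreal (1 / a) * A x) s * epow (ennreal (1 / b) * B x) (1 - s))"
        by (simp add: ennreal_mult' mult_ac)
      also have "\<dots> \<le> ?c * (ennreal s * (ennreal (1 / a) * A x) + ennreal (1 - s) * (ennreal (1 / b) * B x))"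
        by (intro mult_left_mono epow_weighted_am_gm s) auto
      also have "\<dots> = ?c * (ennreal (s / a) * A x + ennreal ((1 - s) / b) * B x)"
        using s ab by (simp add: mult.assoc[symmetric] flip: ennreal_mult')
      finally show ?thesis .
    qed
    then have "(\<integral>\<^sup>+x. epow (A x) s * epow (B x) (1 - s) \<partial>M)
        \<le> (\<integral>\<^sup>+x. ?c * (ennreal (s / a) * A x + ennreal ((1 - s) / b) * B x) \<partial>M)"
      by (intro nn_integral_mono)
    also have "\<dots> = ?c * (ennreal (s / a) * ?a + ennreal ((1 - s) / b) * ?b)"
      by (simp add: nn_integral_cmult nn_integral_add)
    also have "\<dots> = ?c"
      using ab s by (simp flip: ennreal_mult' ennreal_plus)
    also have "\<dots> = epow ?a s * epow ?b (1 - s)"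
      using ab by (simp add: epow_ennreal ennreal_mult')
    finally show ?thesis .
  qed
qed

lemma suminf_Holder:
  assumes "0 < s" "s < 1"
  shows "(\<Sum>n. epow (A n) s * epow (B n) (1 - s)) \<le> epow (\<Sum>n. A n) s * epow (\<Sum>n. B n) (1 - s)"
  using nn_integral_Holder[OF assms, of A "count_space UNIV" B]
  by (simp add: nn_integral_count_space_nat)

lemma nn_integral_change_of_variables:
  fixes g g' F :: "real \<Rightarrow> real"
  assumes S: "S \<in> sets lebesgue"
    and der: "\<And>x. x \<in> S \<Longrightarrow> (g has_field_derivative g' x) (at x within S)"
    and inj: "inj_on g S"
    and F: "F absolutely_integrable_on (g ` S)"
    and nn: "\<And>t. t \<in> g ` S \<Longrightarrow> 0 \<le> F t"
  shows "(\<integral>\<^sup>+x. ennreal (\<bar>g' x\<bar> * F (g x)) \<partial>lebesgue_on S) = ennreal (integral (g ` S) F)"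
proof -
  have *: "(\<lambda>x. \<bar>g' x\<bar> * F (g x)) absolutely_integrable_on S"
    "integral S (\<lambda>x. \<bar>g' x\<bar> * F (g x)) = integral (g ` S) F"
    using has_absolute_integral_change_of_variables_1'[OF S der inj, of F "integral (g ` S) F"] F
    by blast+
  have "integrable (lebesgue_on S) (\<lambda>x. \<bar>g' x\<bar> * F (g x))"
    using *(1) S by (simp add: absolutely_integrable_imp_integrable)
  then have "(\<integral>\<^sup>+x. ennreal (\<bar>g' x\<bar> * F (g x)) \<partial>lebesgue_on S) =
      ennreal (\<integral>x. \<bar>g' x\<bar> * F (g x) \<partial>lebesgue_on S)"
    using S by (intro nn_integral_eq_integral) (auto simp: AE_restrict_space_iff nn intro!: AE_I2)
  also have "(\<integral>x. \<bar>g' x\<bar> * F (g x) \<partial>lebesgue_on S) = integral S (\<lambda>x. \<bar>g' x\<bar> * F (g x))"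
    using \<open>integrable (lebesgue_on S) _\<close> S by (simp add: lebesgue_integral_eq_integral)
  finally show ?thesis using *(2) by simp
qed

section \<open>The kernel and its Mellin transform\<close>

lemma csch_pos: "u > 0 \<Longrightarrow> csch u > 0"
  by (simp add: csch_def)

lemma csch_strict_antimono:
  assumes "0 < u" "u < v"
  shows "csch v < csch u"
proof -
  have "exp u - exp (- u) < exp v - exp (- v)"
    using assms exp_less_mono[of u v] exp_less_mono[of "- v" "- u"] by linarith
  then show ?thesis using assms by (simp add: csch_def frac_less2)
qed

lemma one_plus_power_le: "0 \<le> x \<Longrightarrow> 0 < m \<Longrightarrow> 1 + x ^ m \<le> (1 + x :: real) ^ m"
proof (induction m)
  case (Suc m)
  show ?case
  proof (cases "m = 0")
    case False
    then have "1 + x ^ m \<le> (1 + x) ^ m" using Suc by simp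
    then have "(1 + x) * (1 + x ^ m) \<le> (1 + x) * (1 + x) ^ m"
      using Suc by (intro mult_left_mono) auto
    moreover have "1 + x ^ Suc m \<le> (1 + x) * (1 + x ^ m)"
      using Suc by (simp add: algebra_simps)
    ultimately show ?thesis by simp
  qed simp
qed simp

text \<open>From $e^u = (e^{u/m})^m \<ge> (1 + u/m)^m \<ge> 1 + (u/m)^m$. The case $m = 1$ controls
  the kernel at the origin, a large $m$ controls it at infinity.\<close>

lemma csch_le_power:
  assumes u: "0 < u" and m: "0 < m"
  shows "csch u \<le> 2 * (real m / u) ^ m"
proof -
  have "1 + (u / m) ^ m \<le> (1 + u / m) ^ m"
    using u m by (intro one_plus_power_le) auto
  also have "\<dots> \<le> exp (u / m) ^ m"
    using u m by (intro power_mono exp_ge_add_one_self) auto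
  also have "\<dots> = exp u"
    using m by (simp flip: exp_of_nat_mult)
  finally have "(u / m) ^ m \<le> exp u - exp (- u)"
    using u by (smt (verit) exp_le_one_iff)
  then have "csch u \<le> 2 / (u / m) ^ m"
    unfolding csch_def using u m by (intro divide_left_mono mult_pos_pos) auto
  then show ?thesis using u m by (simp add: power_divide)
qed

lemma has_integral_powr_Ioc:
  assumes "- 1 < b" "0 < a"
  shows "((\<lambda>t::real. t powr b) has_integral (a powr (b + 1) / (b + 1))) {0<..a}"
proof -
  have "{0..a} - {0<..a} = {0}" using assms by auto
  then have *: "negligible {t \<in> {0..a} - {0<..a}. t powr b \<noteq> 0}" by simp
  have "{t \<in> {0<..a} - {0..a}. t powr b \<noteq> 0} = {}" by auto
  then have **: "negligible {t \<in> {0<..a} - {0..a}. t powr b \<noteq> 0}" by (simp only: negligible_empty)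
  show ?thesis
    using has_integral_powr_from_0[of b a] assms has_integral_spike_set_eq[OF ** *] by simp
qed

context
  fixes \<alpha> \<rho> \<gamma> :: real
  assumes \<alpha>: "0 \<le> \<alpha>" and \<rho>: "0 < \<rho>" and \<gamma>: "0 < \<gamma>"
begin

lemma kern_pos: "t > 0 \<Longrightarrow> kern \<alpha> \<rho> \<gamma> t > 0"
  using \<rho> by (simp add: kern_def csch_pos)

lemma kern_strict_antimono:
  assumes "0 < t" "t < u"
  shows "kern \<alpha> \<rho> \<gamma> u < kern \<alpha> \<rho> \<gamma> t"
proof -
  have "t powr \<gamma> < u powr \<gamma>" using assms \<gamma> by (intro powr_less_mono2) auto
  then have "csch (\<rho> * u powr \<gamma>) < csch (\<rho> * t powr \<gamma>)" "exp (\<alpha> * t powr \<gamma>) \<le> exp (\<alpha> * u powr \<gamma>)"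
    using assms \<rho> \<alpha> by (auto intro!: csch_strict_antimono mult_left_mono)
  then show ?thesis
    unfolding kern_def using assms \<rho> csch_pos[of "\<rho> * u powr \<gamma>"] by (intro frac_less) auto
qed

lemma kern_le_powr:
  assumes t: "0 < t" and m: "0 < m"
  shows "kern \<alpha> \<rho> \<gamma> t \<le> 2 * (real m / \<rho>) ^ m * t powr (- \<gamma> * real m)"
proof -
  have "kern \<alpha> \<rho> \<gamma> t \<le> csch (\<rho> * t powr \<gamma>) / 1"
    unfolding kern_def using t \<alpha> \<rho> csch_pos[of "\<rho> * t powr \<gamma>"] by (intro divide_left_mono) auto
  also have "\<dots> \<le> 2 * (real m / (\<rho> * t powr \<gamma>)) ^ m"
    using csch_le_power[of "\<rho> * t powr \<gamma>" m] t \<rho> m by simp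
  also have "\<dots> = 2 * (real m / \<rho>) ^ m * t powr (- \<gamma> * real m)"
    using t \<rho> by (simp add: power_divide power_mult_distrib powr_minus powr_mult_base powr_powr powr_powr_swap
      divide_simps flip: powr_realpow)
  finally show ?thesis .
qed

lemma continuous_on_kern_powr: "continuous_on {0<..} (\<lambda>t. kern \<alpha> \<rho> \<gamma> t * t powr s)"
proof -
  have "exp (\<rho> * t powr \<gamma>) - exp (- (\<rho> * t powr \<gamma>)) \<noteq> 0" if "t > 0" for t
    using that \<rho> by simp
  then show ?thesis
    unfolding kern_def csch_def by (intro continuous_intros) auto
qed

lemma absolutely_integrable_kern_powr:
  assumes s: "\<gamma> < s"
  shows "(\<lambda>t. kern \<alpha> \<rho> \<gamma> t * t powr (s - 1)) absolutely_integrable_on {0<..}"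
proof -
  let ?f = "\<lambda>t. kern \<alpha> \<rho> \<gamma> t * t powr (s - 1)"
  \<comment> \<open>with $s < \<gamma> m$ the bound $t^{s-1-\<gamma> m}$ is integrable at infinity\<close>
  obtain m :: nat where m: "s / \<gamma> < real m" using reals_Archimedean2 by blast
  then have m': "0 < m" "s < \<gamma> * m" using \<gamma> s by (auto simp: field_simps intro: ccontr)
  define C where "C = 2 * (real m / \<rho>) ^ m"
  have cont: "continuous_on S ?f" if "S \<subseteq> {0<..}" for S
    using continuous_on_kern_powr that continuous_on_subset by blast
  have "?f absolutely_integrable_on {0<..1}"
  proof (rule measurable_bounded_by_integrable_imp_absolutely_integrable)
    show "?f \<in> borel_measurable (lebesgue_on {0<..1})"
      by (intro continuous_imp_measurable_on_sets_lebesgue cont) auto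
    show "(\<lambda>t. 2 / \<rho> * t powr (s - 1 - \<gamma>)) integrable_on {0<..1}"
      using s by (intro integrable_on_mult_right integrable_on_powr_from_0') auto
    show "norm (?f t) \<le> 2 / \<rho> * t powr (s - 1 - \<gamma>)" if "t \<in> {0<..1}" for t
    proof -
      have "?f t \<le> (2 / \<rho> * t powr (- \<gamma>)) * t powr (s - 1)"
        using that kern_le_powr[of t 1] by (intro mult_right_mono) auto
      also have "\<dots> = 2 / \<rho> * t powr (s - 1 - \<gamma>)"
        by (simp add: mult.assoc algebra_simps flip: powr_add)
      finally show ?thesis using that kern_pos[of t] by simp
    qed
  qed auto
  moreover have "?f absolutely_integrable_on {1..}"
  proof (rule measurable_bounded_by_integrable_imp_absolutely_integrable)
    show "?f \<in> borel_measurable (lebesgue_on {1..})"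
      by (intro continuous_imp_measurable_on_sets_lebesgue cont) auto
    have "(\<lambda>t. t powr (s - 1 - \<gamma> * m)) integrable_on {1..}"
      using has_integral_powr_to_inf[of "s - 1 - \<gamma> * m" 1] m' by (auto simp: integrable_on_def)
    then show "(\<lambda>t. C * t powr (s - 1 - \<gamma> * m)) integrable_on {1..}"
      by (intro integrable_on_mult_right) auto
    show "norm (?f t) \<le> C * t powr (s - 1 - \<gamma> * m)" if "t \<in> {1..}" for t
    proof -
      have "?f t \<le> (C * t powr (- \<gamma> * m)) * t powr (s - 1)"
        using that kern_le_powr[of t m] m' by (intro mult_right_mono) (auto simp: C_def)
      also have "\<dots> = C * t powr (s - 1 - \<gamma> * m)"
        by (simp add: mult.assoc algebra_simps flip: powr_add)
      finally show ?thesis using that kern_pos[of t] by simp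
    qed
  qed auto
  ultimately have "?f absolutely_integrable_on ({0<..1} \<union> {1..})"
    by (intro set_integrable_Un) auto
  moreover have "{0<..1} \<union> {1..} = {0::real<..}" by auto
  ultimately show ?thesis by simp
qed

lemma set_integrable_kern_powr:
  assumes "\<gamma> < s" "S \<in> sets borel" "S \<subseteq> {0<..}"
  shows "set_integrable lborel S (\<lambda>t. kern \<alpha> \<rho> \<gamma> t * t powr (s - 1))"
proof -
  let ?f = "\<lambda>t. kern \<alpha> \<rho> \<gamma> t * t powr (s - 1)"
  have "(\<lambda>t. indicator {0<..} t *\<^sub>R ?f t) \<in> borel_measurable lborel"
    using borel_measurable_continuous_on_indicator[OF _ continuous_on_kern_powr] by simp
  then have "set_integrable lborel {0<..} ?f"
    using absolutely_integrable_kern_powr[OF assms(1)] by (simp add: set_integrable_def integrable_completion)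
  then show ?thesis by (rule set_integrable_subset) (use assms in auto)
qed

lemma k_eq_integral:
  assumes "\<gamma> < s"
  shows "k \<alpha> \<rho> \<gamma> s = integral {0<..} (\<lambda>t. kern \<alpha> \<rho> \<gamma> t * t powr (s - 1))"
  unfolding k_def using set_integrable_kern_powr[OF assms, of "{0<..}"]
  by (intro set_borel_integral_eq_integral(2)) auto

lemma set_lebesgue_integral_kern_pos:
  assumes s: "\<gamma> < s" and a: "0 \<le> a"
  shows "0 < (LBINT t:{a<..}. kern \<alpha> \<rho> \<gamma> t * t powr (s - 1))"
proof -
  let ?f = "\<lambda>t. kern \<alpha> \<rho> \<gamma> t * t powr (s - 1)"
  have int: "set_integrable lborel {a<..} ?f"
    using a by (intro set_integrable_kern_powr s) auto
  have nn: "0 \<le> indicator {a<..} t * ?f t" for t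
    using a kern_pos[of t] by (auto simp: indicator_def)
  have "(LBINT t:{a<..}. ?f t) \<noteq> 0"
  proof
    assume "(LBINT t:{a<..}. ?f t) = 0"
    then have "AE t in lborel. indicator {a<..} t * ?f t = 0"
      using int nn by (subst (asm) set_lebesgue_integral_def, subst (asm) integral_nonneg_eq_0_iff_AE)
        (auto simp: set_integrable_def)
    then have "AE t in lborel. t \<notin> {a<..}"
      using a kern_pos by (auto elim!: eventually_mono simp: indicator_def less_imp_neq[symmetric] split: if_splits)
    then have "emeasure lborel {a<..} = 0"
      by (subst (asm) AE_iff_measurable[of "{a<..}"]) auto
    moreover have "emeasure lborel {a<..a+1} \<le> emeasure lborel {a<..}"
      by (intro emeasure_mono) auto
    ultimately show False by simp
  qed
  moreover have "0 \<le> (LBINT t:{a<..}. ?f t)"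
    unfolding set_lebesgue_integral_def using nn by (intro integral_nonneg_AE) auto
  ultimately show ?thesis by simp
qed

lemma k_pos: "\<gamma> < s \<Longrightarrow> 0 < k \<alpha> \<rho> \<gamma> s"
  unfolding k_def using set_lebesgue_integral_kern_pos[of s 0] by simp

lemma k_split:
  assumes s: "\<gamma> < s" and a: "0 \<le> a"
  shows "k \<alpha> \<rho> \<gamma> s = (LBINT t:{0<..a}. kern \<alpha> \<rho> \<gamma> t * t powr (s - 1))
           + (LBINT t:{a<..}. kern \<alpha> \<rho> \<gamma> t * t powr (s - 1))"
proof -
  have "(LBINT t:{0<..a} \<union> {a<..}. kern \<alpha> \<rho> \<gamma> t * t powr (s - 1)) =
      (LBINT t:{0<..a}. kern \<alpha> \<rho> \<gamma> t * t powr (s - 1))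
      + (LBINT t:{a<..}. kern \<alpha> \<rho> \<gamma> t * t powr (s - 1))"
    by (rule set_integral_Un) (use a in \<open>auto intro!: set_integrable_kern_powr s\<close>)
  moreover have "{0<..a} \<union> {a<..} = {0<..}" using a by auto
  ultimately show ?thesis by (simp add: k_def)
qed

text \<open>The substitution $t = c v$. With $c = U(x)^\<delta>$ and $a = V_{n_0}$ it carries the integral that
  bounds the weight sum into the one that defines $1 - \<theta>$.\<close>

lemma nn_integral_kern_tail:
  assumes s: "\<gamma> < s" and c: "0 < c" and a: "0 < a"
  shows "(\<integral>\<^sup>+v. ennreal (kern \<alpha> \<rho> \<gamma> (c * v) * v powr (s - 1)) \<partial>lebesgue_on {a<..})
       = ennreal (c powr (- s) * (LBINT t:{c * a<..}. kern \<alpha> \<rho> \<gamma> t * t powr (s - 1)))"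
proof -
  let ?F = "\<lambda>t. c powr (- s) * (kern \<alpha> \<rho> \<gamma> t * t powr (s - 1))"
  have img: "(\<lambda>v. c * v) ` {a<..} = {c * a<..}"
  proof -
    have "t \<in> (\<lambda>v. c * v) ` {a<..}" if "c * a < t" for t
      using that c by (intro image_eqI[of _ _ "t / c"]) (auto simp: field_simps)
    then show ?thesis using c by auto
  qed
  have sub: "{c * a<..} \<subseteq> {0<..}" using c a by (smt (verit) greaterThan_subset_iff mult_pos_pos)
  have int: "set_integrable lborel {c * a<..} (\<lambda>t. kern \<alpha> \<rho> \<gamma> t * t powr (s - 1))"
    using sub by (intro set_integrable_kern_powr s) auto
  have "(\<integral>\<^sup>+v. ennreal (kern \<alpha> \<rho> \<gamma> (c * v) * v powr (s - 1)) \<partial>lebesgue_on {a<..})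
      = (\<integral>\<^sup>+v. ennreal (\<bar>c\<bar> * ?F (c * v)) \<partial>lebesgue_on {a<..})"
  proof (intro nn_integral_cong arg_cong[where f = ennreal])
    fix v assume "v \<in> space (lebesgue_on {a<..})"
    then have "v > 0" using a by simp
    then show "kern \<alpha> \<rho> \<gamma> (c * v) * v powr (s - 1) = \<bar>c\<bar> * ?F (c * v)"
      using c by (simp add: powr_mult powr_minus powr_diff field_simps)
  qed
  also have "\<dots> = ennreal (integral ((\<lambda>v. c * v) ` {a<..}) ?F)"
  proof (rule nn_integral_change_of_variables)
    show "((\<lambda>v. c * v) has_field_derivative c) (at x within {a<..})" for x
      by (auto intro!: derivative_eq_intros)
    show "inj_on (\<lambda>v. c * v) {a<..}" using c by (auto intro: inj_onI)
    show "?F absolutely_integrable_on (\<lambda>v. c * v) ` {a<..}"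
      unfolding img using sub
      by (intro set_integrable_mult_right set_integrable_subset[OF absolutely_integrable_kern_powr[OF s]]) auto
    show "0 \<le> ?F t" if "t \<in> (\<lambda>v. c * v) ` {a<..}" for t
      using that sub kern_pos[of t] unfolding img by auto
  qed simp
  also have "integral ((\<lambda>v. c * v) ` {a<..}) ?F = c powr (- s) * (LBINT t:{c * a<..}. kern \<alpha> \<rho> \<gamma> t * t powr (s - 1))"
    unfolding img using set_borel_integral_eq_integral(2)[OF int] by simp
  finally show ?thesis .
qed

text \<open>Near the origin the kernel is at most a multiple of $t^{-\<gamma>}$. This makes the defect
  $\<theta>$ small where $U^\<delta>$ is small.\<close>

lemma kern_initial_le:
  assumes s: "\<gamma> < s" and a: "0 < a"
  shows "(LBINT t:{0<..a}. kern \<alpha> \<rho> \<gamma> t * t powr (s - 1)) \<le> 2 / (\<rho> * (s - \<gamma>)) * a powr (s - \<gamma>)"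
proof -
  let ?f = "\<lambda>t. kern \<alpha> \<rho> \<gamma> t * t powr (s - 1)"
  have int: "set_integrable lborel {0<..a} ?f"
    by (intro set_integrable_kern_powr s) auto
  have *: "((\<lambda>t. t powr (s - 1 - \<gamma>)) has_integral (a powr (s - \<gamma>) / (s - \<gamma>))) {0<..a}"
    using has_integral_powr_Ioc[of "s - 1 - \<gamma>" a] s a by (simp add: algebra_simps)
  have "(LBINT t:{0<..a}. ?f t) = integral {0<..a} ?f"
    using set_borel_integral_eq_integral(2)[OF int] .
  also have "\<dots> \<le> integral {0<..a} (\<lambda>t. 2 / \<rho> * t powr (s - 1 - \<gamma>))"
  proof (rule integral_le)
    show "?f integrable_on {0<..a}" using set_borel_integral_eq_integral(1)[OF int] .
    show "(\<lambda>t. 2 / \<rho> * t powr (s - 1 - \<gamma>)) integrable_on {0<..a}"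
      using * by (intro integrable_on_mult_right) (auto simp: integrable_on_def)
    show "?f t \<le> 2 / \<rho> * t powr (s - 1 - \<gamma>)" if "t \<in> {0<..a}" for t
    proof -
      have "?f t \<le> (2 / \<rho> * t powr (- \<gamma>)) * t powr (s - 1)"
        using that kern_le_powr[of t 1] by (intro mult_right_mono) auto
      also have "\<dots> = 2 / \<rho> * t powr (s - 1 - \<gamma>)"
        by (simp add: mult.assoc algebra_simps flip: powr_add)
      finally show ?thesis .
    qed
  qed
  also have "\<dots> = 2 / \<rho> * (a powr (s - \<gamma>) / (s - \<gamma>))"
    using * by (simp add: integral_unique)
  finally show ?thesis by (simp add: field_simps)
qed

text \<open>Dominated convergence, because $t^{S_j - 1} \<le> t^{s-1} + t^s$ for
  $s \<le> S_j \<le> s + 1$. The test functions shift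
  $\<sigma>$ upwards, so the limit is taken from the right.\<close>

lemma k_right_continuous:
  assumes s: "\<gamma> < s" and lim: "S \<longlonglongrightarrow> s" and S: "\<And>j. s \<le> S j" "\<And>j. S j \<le> s + 1"
  shows "(\<lambda>j. k \<alpha> \<rho> \<gamma> (S j)) \<longlonglongrightarrow> k \<alpha> \<rho> \<gamma> s"
  unfolding k_def set_lebesgue_integral_def
proof (rule integral_dominated_convergence[where w = "\<lambda>t. indicator {0<..} t *\<^sub>R (kern \<alpha> \<rho> \<gamma> t * t powr (s - 1))
     + indicator {0<..} t *\<^sub>R (kern \<alpha> \<rho> \<gamma> t * t powr (s + 1 - 1))"])
  show "integrable lborel (\<lambda>t. indicator {0<..} t *\<^sub>R (kern \<alpha> \<rho> \<gamma> t * t powr (s - 1))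
     + indicator {0<..} t *\<^sub>R (kern \<alpha> \<rho> \<gamma> t * t powr (s + 1 - 1)))"
    using set_integrable_kern_powr[of s "{0<..}"] set_integrable_kern_powr[of "s + 1" "{0<..}"] s
    unfolding set_integrable_def by (intro Bochner_Integration.integrable_add) auto
  have meas: "(\<lambda>t. indicator {0<..} t *\<^sub>R (kern \<alpha> \<rho> \<gamma> t * t powr r)) \<in> borel_measurable lborel" for r
    using borel_measurable_continuous_on_indicator[OF _ continuous_on_kern_powr] by simp
  show "(\<lambda>t. indicator {0<..} t *\<^sub>R (kern \<alpha> \<rho> \<gamma> t * t powr (s - 1))) \<in> borel_measurable lborel"
    "\<And>j. (\<lambda>t. indicator {0<..} t *\<^sub>R (kern \<alpha> \<rho> \<gamma> t * t powr (S j - 1))) \<in> borel_measurable lborel"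
    by (rule meas)+
  show "AE t in lborel. (\<lambda>j. indicator {0<..} t *\<^sub>R (kern \<alpha> \<rho> \<gamma> t * t powr (S j - 1)))
      \<longlonglongrightarrow> indicator {0<..} t *\<^sub>R (kern \<alpha> \<rho> \<gamma> t * t powr (s - 1))"
  proof (intro always_eventually allI)
    fix t :: real
    show "(\<lambda>j. indicator {0<..} t *\<^sub>R (kern \<alpha> \<rho> \<gamma> t * t powr (S j - 1)))
      \<longlonglongrightarrow> indicator {0<..} t *\<^sub>R (kern \<alpha> \<rho> \<gamma> t * t powr (s - 1))"
      by (cases "t > 0") (auto intro!: tendsto_intros lim)
  qed
  show "AE t in lborel. norm (indicator {0<..} t *\<^sub>R (kern \<alpha> \<rho> \<gamma> t * t powr (S j - 1)))
      \<le> indicator {0<..} t *\<^sub>R (kern \<alpha> \<rho> \<gamma> t * t powr (s - 1))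
       + indicator {0<..} t *\<^sub>R (kern \<alpha> \<rho> \<gamma> t * t powr (s + 1 - 1))" for j
  proof (intro always_eventually allI)
    fix t :: real
    show "norm (indicator {0<..} t *\<^sub>R (kern \<alpha> \<rho> \<gamma> t * t powr (S j - 1)))
      \<le> indicator {0<..} t *\<^sub>R (kern \<alpha> \<rho> \<gamma> t * t powr (s - 1))
       + indicator {0<..} t *\<^sub>R (kern \<alpha> \<rho> \<gamma> t * t powr (s + 1 - 1))"
    proof (cases "t > 0")
      case True
      have "t powr (S j - 1) \<le> t powr (s - 1) + t powr (s + 1 - 1)"
      proof (cases "t \<le> 1")
        case True
        then have "t powr (S j - 1) \<le> t powr (s - 1)"
          using \<open>t > 0\<close> S(1)[of j] by (intro powr_mono') auto
        then show ?thesis by (smt (verit) powr_ge_zero)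
      next
        case False
        then have "t powr (S j - 1) \<le> t powr (s + 1 - 1)"
          using S(2)[of j] by (intro powr_mono) auto
        then show ?thesis by (smt (verit) powr_ge_zero)
      qed
      then have "kern \<alpha> \<rho> \<gamma> t * t powr (S j - 1) \<le> kern \<alpha> \<rho> \<gamma> t * (t powr (s - 1) + t powr (s + 1 - 1))"
        using kern_pos[OF True] by (intro mult_left_mono) auto
      then show ?thesis using True kern_pos[OF True] by (simp add: algebra_simps)
    qed simp
  qed
qed

end

section \<open>Auxiliary facts on powers, series and integrals\<close>

text \<open>A single step of the integral test for $\sum \<nu>_n V_n^{-1-e}$, in a form that telescopes.\<close>

lemma powr_difference_ge:
  assumes "0 < a" "a < b" "0 < e"
  shows "(b - a) * b powr (- 1 - e) \<le> (a powr (- e) - b powr (- e)) / (e::real)"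
proof -
  have "((\<lambda>x. x powr (- e)) has_real_derivative (- e * x powr (- e - 1))) (at x)" if "a \<le> x" for x
    using that assms by (auto intro!: derivative_eq_intros simp: powr_diff)
  from MVT2[OF \<open>a < b\<close> this] obtain z where z: "a < z" "z < b"
    "b powr (- e) - a powr (- e) = (b - a) * (- e * z powr (- e - 1))" by blast
  have "b powr (- 1 - e) \<le> z powr (- e - 1)"
  proof -
    have "b powr (- e - 1) \<le> z powr (- e - 1)" using z assms by (intro powr_mono2') auto
    moreover have "- e - 1 = - 1 - e" by simp
    ultimately show ?thesis by (simp only:)
  qed
  then have "(b - a) * b powr (- 1 - e) \<le> (b - a) * z powr (- e - 1)"
    using assms by (intro mult_left_mono) auto
  also have "\<dots> = (a powr (- e) - b powr (- e)) / e"
    using z(3) assms by (simp add: field_simps)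
  finally show ?thesis .
qed

lemma not_AE_False_lebesgue_on_greaterThan: "\<not> (AE x in lebesgue_on {a::real<..}. False)"
proof
  assume "AE x in lebesgue_on {a<..}. False"
  then have "emeasure (lebesgue_on {a<..}) {a<..} = 0"
    by (subst (asm) AE_iff_measurable[of "{a<..}"]) auto
  then have "emeasure lborel {a<..} = 0"
    by (simp add: emeasure_restrict_space)
  moreover have "emeasure lborel {a<..a + 1} \<le> emeasure lborel {a<..}"
    by (intro emeasure_mono) auto
  ultimately show False by simp
qed

lemma nn_integral_less_greaterThan:
  fixes f g :: "real \<Rightarrow> ennreal"
  assumes "f \<in> borel_measurable (lebesgue_on {a<..})" "g \<in> borel_measurable (lebesgue_on {a<..})"
    and "(\<integral>\<^sup>+x. f x \<partial>lebesgue_on {a<..}) \<noteq> \<infinity>" "\<And>x. x > a \<Longrightarrow> f x < g x"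
  shows "(\<integral>\<^sup>+x. f x \<partial>lebesgue_on {a<..}) < (\<integral>\<^sup>+x. g x \<partial>lebesgue_on {a<..})"
proof (rule nn_integral_less)
  show "AE x in lebesgue_on {a<..}. f x \<le> g x"
    using assms(4) by (intro AE_I2) (auto intro: less_imp_le)
  show "\<not> (AE x in lebesgue_on {a<..}. g x \<le> f x)"
  proof
    assume "AE x in lebesgue_on {a<..}. g x \<le> f x"
    then have "AE x in lebesgue_on {a<..}. False"
      by (rule AE_mp) (use assms(4) in \<open>auto intro!: AE_I2 simp: not_le\<close>)
    then show False using not_AE_False_lebesgue_on_greaterThan by blast
  qed
qed (use assms in auto)

lemma ennreal_le_suminf: "(f :: nat \<Rightarrow> ennreal) n \<le> suminf f"
  using sum_le_suminf[OF summableI, of "{n}" f] by simp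

section \<open>The setting\<close>

locale half_discrete_reverse =
  fixes \<alpha> \<rho> \<gamma> \<sigma> \<delta> p q :: real
    and \<mu> :: "real \<Rightarrow> real" and \<nu> \<nu>t :: "nat \<Rightarrow> real" and n0 :: nat
  assumes nu_pos: "\<And>n. n \<ge> 1 \<Longrightarrow> \<nu> n > 0"
    and nut: "\<And>n. n \<ge> 1 \<Longrightarrow> 0 \<le> \<nu>t n" "\<And>n. n \<ge> 1 \<Longrightarrow> \<nu>t n \<le> \<nu> n / 2"
    and mu_cont: "continuous_on {0<..} \<mu>" and mu_pos: "\<And>x. x > 0 \<Longrightarrow> \<mu> x > 0"
    and mu_int: "\<And>x. x > 0 \<Longrightarrow> set_integrable lborel {0<..x} \<mu>"
    and alpha: "0 \<le> \<alpha>" and rho: "0 < \<rho>"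
    and gamma: "0 < \<gamma>" and gamma_less: "\<gamma> < \<sigma>" and sigma_le: "\<sigma> \<le> 1"
    and delta: "\<delta> = - 1 \<or> \<delta> = 1"
    and p: "0 < p" "p < 1" and pq: "1 / p + 1 / q = 1"
    and n0: "n0 \<ge> 1" and nu_decr: "\<And>n. n \<ge> n0 \<Longrightarrow> \<nu> (Suc n) \<le> \<nu> n"
    and U_inf: "U_infinity \<mu> = \<infinity>" and V_inf: "V_infinity \<nu> = \<infinity>"
begin

abbreviation "ker \<equiv> kern \<alpha> \<rho> \<gamma>"
abbreviation "kk \<equiv> k \<alpha> \<rho> \<gamma>"
abbreviation "h \<equiv> H \<alpha> \<rho> \<gamma> \<delta> \<mu> \<nu> \<nu>t"
abbreviation "th \<equiv> \<theta> \<alpha> \<rho> \<gamma> \<delta> \<mu> \<nu> n0 \<sigma>"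
abbreviation "W \<equiv> Vt \<nu> \<nu>t"
abbreviation "R \<equiv> lebesgue_on {0::real<..}"

lemmas ker_pos = kern_pos[OF alpha rho gamma]
lemmas ker_strict_antimono = kern_strict_antimono[OF alpha rho gamma]

lemma ker_continuous: "continuous_on {0<..} ker"
  by (rule continuous_on_eq[OF continuous_on_kern_powr[OF alpha rho gamma, of 0]]) auto

lemma q_eq: "q = p / (p - 1)"
proof -
  have "q \<noteq> 0" using pq p by auto
  then show ?thesis using pq p by (simp add: field_simps)
qed

lemma q_neg: "q < 0"
  unfolding q_eq using p by (intro divide_pos_neg) auto

lemma exponents: "q * (1 - p) = - p" "1 - q = 1 / (1 - p)" "(1 - q) * (1 - p) = 1" "(1 - p) / p = - 1 / q"
  using p by (simp_all add: q_eq divide_simps) (simp_all add: algebra_simps)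

section \<open>The substitution by a power of U\<close>

lemma U_diff:
  assumes "0 < a" "a \<le> y"
  shows "U \<mu> y = U \<mu> a + integral {a..y} \<mu>"
proof -
  have int: "set_integrable lborel {a<..y} \<mu>" "set_integrable lborel {a..y} \<mu>"
    using continuous_on_subset[OF mu_cont, of "{a..y}"] assms
    by (auto intro: borel_integrable_atLeastAtMost' set_integrable_subset[OF mu_int[of y]])
  then have "(LBINT t:{0<..a} \<union> {a<..y}. \<mu> t) = (LBINT t:{0<..a}. \<mu> t) + (LBINT t:{a<..y}. \<mu> t)"
    using assms by (intro set_integral_Un mu_int) auto
  moreover have "{0<..a} \<union> {a<..y} = {0<..y}" using assms by auto
  moreover have "(LBINT t:{a<..y}. \<mu> t) = (LBINT t:{a..y}. \<mu> t)"
  proof (rule set_integral_cong_set)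
    show "set_borel_measurable lborel {a..y} \<mu>"
      using int(2) unfolding set_integrable_def set_borel_measurable_def by (rule borel_measurable_integrable)
    show "set_borel_measurable lborel {a<..y} \<mu>"
      using int(1) unfolding set_integrable_def set_borel_measurable_def by (rule borel_measurable_integrable)
    show "AE x in lborel. (x \<in> {a..y}) = (x \<in> {a<..y})"
      using AE_lborel_singleton[of a] by (auto elim!: eventually_mono)
  qed
  moreover have "(LBINT t:{a..y}. \<mu> t) = integral {a..y} \<mu>"
    using int(2) by (rule set_borel_integral_eq_integral(2))
  ultimately show ?thesis by (simp add: U_def)
qed

lemma U_deriv:
  assumes "x > 0"
  shows "(U \<mu> has_real_derivative \<mu> x) (at x)"
proof -
  have cont: "continuous_on {x/2..x+1} \<mu>"
    by (rule continuous_on_subset[OF mu_cont]) (use assms in auto)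
  have "((\<lambda>y. U \<mu> (x/2) + integral {x/2..y} \<mu>) has_real_derivative \<mu> x) (at x within {x/2..x+1})"
    using integral_has_real_derivative[OF cont, of x] assms by (auto intro!: derivative_eq_intros)
  then have "(U \<mu> has_real_derivative \<mu> x) (at x within {x/2..x+1})"
    by (rule has_field_derivative_transform_within[where d = 1]) (use assms in \<open>auto intro: U_diff[symmetric]\<close>)
  moreover have "at x within {x/2..x+1} = at x"
    using assms by (intro at_within_interior) auto
  ultimately show ?thesis by simp
qed

lemma U_strict_mono: "0 < x \<Longrightarrow> x < y \<Longrightarrow> U \<mu> x < U \<mu> y"
  by (rule DERIV_pos_imp_increasing[of x y]) (auto intro!: exI U_deriv mu_pos)

lemma U_pos: 
  assumes "x > 0" shows "U \<mu> x > 0"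
proof -
  have "0 \<le> U \<mu> (x / 2)"
    unfolding U_def set_lebesgue_integral_def using mu_pos
    by (intro integral_nonneg_AE) (auto intro!: AE_I2 simp: indicator_def less_imp_le)
  also have "\<dots> < U \<mu> x" using assms by (intro U_strict_mono) auto
  finally show ?thesis .
qed

lemma U_continuous: "continuous_on {0<..} (U \<mu>)"
  by (auto intro!: continuous_at_imp_continuous_on intro: DERIV_isCont U_deriv)

lemma U_small:
  assumes "0 < e"
  obtains x where "0 < x" "U \<mu> x < e"
proof -
  have "(\<lambda>n. U \<mu> (1 / real (Suc n))) \<longlonglongrightarrow> (\<integral>t. 0 \<partial>(lborel :: real measure))"
    unfolding U_def set_lebesgue_integral_def
  proof (rule integral_dominated_convergence[where w = "\<lambda>t. indicator {0<..1} t *\<^sub>R \<mu> t"])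
    show "integrable lborel (\<lambda>t. indicator {0<..1} t *\<^sub>R \<mu> t)"
      using mu_int[of 1] by (simp add: set_integrable_def)
    show "(\<lambda>t. indicator {0<..1 / real (Suc n)} t *\<^sub>R \<mu> t) \<in> borel_measurable lborel" for n
      using mu_int[of "1 / real (Suc n)"] unfolding set_integrable_def by (intro borel_measurable_integrable) auto
    show "AE t in lborel. norm (indicator {0<..1 / real (Suc n)} t *\<^sub>R \<mu> t) \<le> indicator {0<..1} t *\<^sub>R \<mu> t" for n
    proof (intro AE_I2)
      fix t :: real
      have "t \<le> 1" if "t \<le> 1 / real (Suc n)"
        using that by (rule order_trans) simp
      then show "norm (indicator {0<..1 / real (Suc n)} t *\<^sub>R \<mu> t) \<le> indicator {0<..1} t *\<^sub>R \<mu> t"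
        using mu_pos[of t] by (auto simp: indicator_def simp del: of_nat_Suc)
    qed
    show "AE t in lborel. (\<lambda>n. indicator {0<..1 / real (Suc n)} t *\<^sub>R \<mu> t) \<longlonglongrightarrow> 0"
    proof (intro AE_I2)
      fix t :: real
      show "(\<lambda>n. indicator {0<..1 / real (Suc n)} t *\<^sub>R \<mu> t) \<longlonglongrightarrow> 0"
      proof (cases "t > 0")
        case True
        have "eventually (\<lambda>n. 1 / real (Suc n) < t) sequentially"
          using order_tendstoD(2)[OF LIMSEQ_inverse_real_of_nat True] by (simp add: inverse_eq_divide)
        then have "eventually (\<lambda>n. indicator {0<..1 / real (Suc n)} t *\<^sub>R \<mu> t = 0) sequentially"
          by eventually_elim auto
        then show ?thesis by (rule tendsto_eventually)
      qed simp
    qed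
  qed simp
  then have "eventually (\<lambda>n. U \<mu> (1 / real (Suc n)) < e) sequentially"
    using assms by (intro order_tendstoD(2)) auto
  then obtain n where "U \<mu> (1 / real (Suc n)) < e" by (auto simp: eventually_sequentially)
  then show thesis by (intro that[of "1 / real (Suc n)"]) auto
qed

lemma U_large: obtains x where "0 < x" "B < U \<mu> x"
proof (rule ccontr)
  assume "\<not> thesis"
  with that have le: "U \<mu> x \<le> B" if "x > 0" for x using that by force
  let ?f = "\<lambda>n::nat. \<lambda>t. ennreal (\<mu> t) * indicator {0<..real (Suc n)} t"
  have meas: "(\<lambda>t. indicator {0<..x} t *\<^sub>R \<mu> t) \<in> borel_measurable lborel" if "x > 0" for x
    using mu_int[OF that] unfolding set_integrable_def by (intro borel_measurable_integrable) auto
  have eq: "?f n t = ennreal (indicator {0<..real (Suc n)} t *\<^sub>R \<mu> t)" for n t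
    by (auto simp: indicator_def)
  have "U_infinity \<mu> = (\<integral>\<^sup>+t. (SUP n. ?f n t) \<partial>lborel)"
    unfolding U_infinity_def
  proof (intro nn_integral_cong antisym)
    fix t :: real
    show "ennreal (\<mu> t) * indicator {0<..} t \<le> (SUP n. ?f n t)"
    proof (cases "t > 0")
      case True
      obtain n where "t \<le> real n" using real_arch_simple by blast
      then have "ennreal (\<mu> t) * indicator {0<..} t = ?f n t" using True by (auto simp: indicator_def)
      also have "\<dots> \<le> (SUP n. ?f n t)" by (intro SUP_upper) auto
      finally show ?thesis .
    qed simp
    show "(SUP n. ?f n t) \<le> ennreal (\<mu> t) * indicator {0<..} t"
      by (intro SUP_least) (auto simp: indicator_def)
  qed
  also have "\<dots> = (SUP n. \<integral>\<^sup>+t. ?f n t \<partial>lborel)"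
  proof (rule nn_integral_monotone_convergence_SUP)
    show "incseq ?f" by (auto simp: incseq_def le_fun_def indicator_def)
    show "?f n \<in> borel_measurable lborel" for n
      unfolding eq using meas[of "real (Suc n)"] by measurable
  qed
  also have "\<dots> \<le> ennreal B"
  proof (intro SUP_least)
    fix n :: nat
    have "(\<integral>\<^sup>+t. ?f n t \<partial>lborel) = ennreal (U \<mu> (real (Suc n)))"
      unfolding eq U_def set_lebesgue_integral_def using mu_int[of "real (Suc n)"] mu_pos
      by (intro nn_integral_eq_integral AE_I2) (auto simp: set_integrable_def indicator_def less_imp_le)
    then show "(\<integral>\<^sup>+t. ?f n t \<partial>lborel) \<le> ennreal B"
      using le[of "real (Suc n)"] by (simp add: ennreal_leI)
  qed
  finally show False using U_inf by (simp add: top_unique)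
qed

text \<open>Since $U$ increases continuously from $0$ to $\<infinity>$, the map $x \<mapsto> c\,U(x)^\<delta>$
  is a bijection of the half-line onto itself, decreasing for $\<delta> = -1$.\<close>

lemma U_onto:
  assumes "0 < t" obtains x where "0 < x" "U \<mu> x = t"
proof -
  obtain a where a: "0 < a" "U \<mu> a < t" using U_small[OF assms] .
  obtain b where b: "0 < b" "t < U \<mu> b" using U_large .
  have "a < b"
    using a b U_strict_mono[of b a] by (cases a b rule: linorder_cases) auto
  have "continuous_on {a..b} (U \<mu>)"
    by (rule continuous_on_subset[OF U_continuous]) (use a in auto)
  then obtain x where "a \<le> x" "x \<le> b" "U \<mu> x = t"
    using IVT'[of "U \<mu>" a t b] a b \<open>a < b\<close> by (auto simp: less_imp_le)
  then show thesis using a by (intro that[of x]) auto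
qed

text \<open>The substitution $t = c\,U(x)^\<delta>$. The absolute value of the derivative absorbs the sign
  of $\<delta>$, so that both cases are treated at once.\<close>

lemma nn_integral_substitution_U:
  assumes c: "c > 0" and F: "F absolutely_integrable_on {0<..}" and nn: "\<And>t. t > 0 \<Longrightarrow> 0 \<le> F t"
  shows "(\<integral>\<^sup>+x. ennreal (c * U \<mu> x powr (\<delta> - 1) * \<mu> x * F (U \<mu> x powr \<delta> * c)) \<partial>R)
    = ennreal (integral {0<..} F)"
proof -
  let ?g = "\<lambda>x. U \<mu> x powr \<delta> * c"
  let ?g' = "\<lambda>x. \<delta> * U \<mu> x powr (\<delta> - 1) * \<mu> x * c"
  have d0: "\<delta> \<noteq> 0" using delta by auto
  have img: "?g ` {0<..} = {0<..}"
  proof safe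
    fix x :: real assume "x > 0"
    then show "?g x > 0" using c U_pos[of x] by simp
  next
    fix t :: real assume "t > 0"
    then obtain x where "x > 0" "U \<mu> x = (t / c) powr (1 / \<delta>)"
      using U_onto[of "(t / c) powr (1 / \<delta>)"] c by auto
    then have "x \<in> {0<..}" "?g x = t" using d0 c \<open>t > 0\<close> by (auto simp: powr_powr)
    then show "t \<in> ?g ` {0<..}" by (metis image_eqI)
  qed
  have inj: "inj_on ?g {0<..}"
  proof (rule inj_onI)
    fix x y :: real assume xy: "x \<in> {0<..}" "y \<in> {0<..}" and eq: "?g x = ?g y"
    then have "(U \<mu> x powr \<delta>) powr (1 / \<delta>) = (U \<mu> y powr \<delta>) powr (1 / \<delta>)" using c by simp
    then have "U \<mu> x = U \<mu> y" using d0 U_pos[of x] U_pos[of y] xy by (simp add: powr_powr)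
    then show "x = y" using U_strict_mono[of x y] U_strict_mono[of y x] xy
      by (cases x y rule: linorder_cases) auto
  qed
  have der: "(?g has_field_derivative ?g' x) (at x within {0<..})" if "x \<in> {0<..}" for x
  proof (rule DERIV_subset)
    show "(?g has_field_derivative ?g' x) (at x)"
      using that U_pos[of x] U_deriv[of x]
      by (auto intro!: derivative_eq_intros DERIV_powr simp: field_simps powr_diff)
  qed simp
  have "(\<integral>\<^sup>+x. ennreal (c * U \<mu> x powr (\<delta> - 1) * \<mu> x * F (?g x)) \<partial>R)
      = (\<integral>\<^sup>+x. ennreal (\<bar>?g' x\<bar> * F (?g x)) \<partial>R)"
  proof (intro nn_integral_cong arg_cong[where f = ennreal])
    fix x assume "x \<in> space R"
    then have "\<bar>?g' x\<bar> = c * U \<mu> x powr (\<delta> - 1) * \<mu> x"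
      using delta c mu_pos[of x] U_pos[of x] by (auto simp: abs_mult)
    then show "c * U \<mu> x powr (\<delta> - 1) * \<mu> x * F (?g x) = \<bar>?g' x\<bar> * F (?g x)" by simp
  qed
  also have "\<dots> = ennreal (integral (?g ` {0<..}) F)"
    by (rule nn_integral_change_of_variables) (use inj der F nn img in auto)
  finally show ?thesis by (simp add: img)
qed

text \<open>The weight that belongs to the integral over $x$ is computed exactly. No estimate is lost
  here, which is why $k(\<sigma>)$ appears without a defect on the side of the sequence.\<close>

lemma nn_integral_kern_U:
  assumes s: "\<gamma> < s" and c: "c > 0"
  shows "(\<integral>\<^sup>+x. ennreal (ker (U \<mu> x powr \<delta> * c) * U \<mu> x powr (\<delta> * s - 1) * \<mu> x) \<partial>R)
    = ennreal (c powr (- s) * kk s)"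
proof -
  let ?F = "\<lambda>t. c powr (- s) * (ker t * t powr (s - 1))"
  have "(\<integral>\<^sup>+x. ennreal (ker (U \<mu> x powr \<delta> * c) * U \<mu> x powr (\<delta> * s - 1) * \<mu> x) \<partial>R)
    = (\<integral>\<^sup>+x. ennreal (c * U \<mu> x powr (\<delta> - 1) * \<mu> x * ?F (U \<mu> x powr \<delta> * c)) \<partial>R)"
  proof (intro nn_integral_cong arg_cong[where f = ennreal])
    fix x assume "x \<in> space R"
    then have u: "U \<mu> x > 0" using U_pos by simp
    have "c * U \<mu> x powr (\<delta> - 1) * \<mu> x * ?F (U \<mu> x powr \<delta> * c)
      = ker (U \<mu> x powr \<delta> * c) * \<mu> x * (U \<mu> x powr (\<delta> - 1) * U \<mu> x powr (\<delta> * (s - 1)))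
        * (c powr 1 * c powr (- s) * c powr (s - 1))"
      using u c by (simp add: powr_mult powr_powr)
    also have "\<dots> = ker (U \<mu> x powr \<delta> * c) * U \<mu> x powr (\<delta> * s - 1) * \<mu> x"
      using u c by (simp add: algebra_simps flip: powr_add)
    finally show "ker (U \<mu> x powr \<delta> * c) * U \<mu> x powr (\<delta> * s - 1) * \<mu> x =
      c * U \<mu> x powr (\<delta> - 1) * \<mu> x * ?F (U \<mu> x powr \<delta> * c)" by (rule sym)
  qed
  also have "\<dots> = ennreal (integral {0<..} ?F)"
    using absolutely_integrable_kern_powr[OF alpha rho gamma s] ker_pos c
    by (intro nn_integral_substitution_U c set_integrable_mult_right) (auto simp: less_imp_le)
  also have "integral {0<..} ?F = c powr (- s) * kk s"
    using k_eq_integral[OF alpha rho gamma s] by simp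
  finally show ?thesis .
qed

section \<open>The weight sum\<close>

lemma V_Suc: "V \<nu> (Suc n) = V \<nu> n + \<nu> (Suc n)"
  by (simp add: V_def)

lemma V_strict_mono: "m < n \<Longrightarrow> V \<nu> m < V \<nu> n"
  by (rule lift_Suc_mono_less) (auto simp: V_Suc nu_pos)

lemma V_mono: "m \<le> n \<Longrightarrow> V \<nu> m \<le> V \<nu> n"
  using V_strict_mono[of m n] by (cases "m = n") auto

lemma V_pos: "n \<ge> 1 \<Longrightarrow> V \<nu> n > 0"
  using V_strict_mono[of 0 n] by (simp add: V_def)

lemma W_le: "n \<ge> 1 \<Longrightarrow> W n \<le> V \<nu> n"
  using nut(1)[of n] by (simp add: Vt_def)

text \<open>Because $\<nu>_n / 2 \<le> \<nu>_n$, the modified partial sum stays above the preceding one.\<close>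

lemma W_ge: "V \<nu> n \<le> W (Suc n)"
  using nut(2)[of "Suc n"] nu_pos[of "Suc n"] by (simp add: Vt_def V_Suc)

lemma W_pos: 
  assumes "n \<ge> 1" shows "W n > 0"
proof -
  obtain m where m: "n = Suc m" using assms by (cases n) auto
  have "0 \<le> V \<nu> m" using V_mono[of 0 m] by (simp add: V_def)
  then show ?thesis using nut(2)[of n] nu_pos[of n] assms by (simp add: Vt_def V_Suc m)
qed

lemma V_large: obtains n where "n \<ge> m" "B < V \<nu> n"
proof (rule ccontr)
  assume "\<not> thesis"
  with that have le: "V \<nu> n \<le> B" if "n \<ge> m" for n using that by force
  have "V_infinity \<nu> \<le> ennreal B"
    unfolding V_infinity_def
  proof (rule suminf_le_const[OF summableI])
    fix n
    have "(\<Sum>i<n. ennreal (\<nu> (Suc i))) = ennreal (\<Sum>i<n. \<nu> (Suc i))"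
      using nu_pos by (intro sum_ennreal) (auto simp: less_imp_le)
    also have "(\<Sum>i<n. \<nu> (Suc i)) = V \<nu> n"
      unfolding V_def by (induction n) (auto simp: sum.atLeast1_atMost_eq)
    also have "V \<nu> n \<le> V \<nu> (max m n)" by (intro V_mono) auto
    also have "\<dots> \<le> B" by (intro le) auto
    finally show "(\<Sum>i<n. ennreal (\<nu> (Suc i))) \<le> ennreal B" by (simp add: ennreal_leI)
  qed
  then show False using V_inf by (simp add: top_unique)
qed

lemma V_interval:
  assumes "V \<nu> n0 < v"
  obtains n where "V \<nu> (n0 + n) < v" "v \<le> V \<nu> (Suc (n0 + n))"
proof -
  obtain N where N: "N \<ge> n0" "v < V \<nu> N" using V_large .
  define n where "n = (LEAST n. v \<le> V \<nu> (n0 + n))"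
  have ex: "v \<le> V \<nu> (n0 + (N - n0))" using N by simp
  then have n: "v \<le> V \<nu> (n0 + n)" unfolding n_def by (rule LeastI)
  have "n \<noteq> 0" using n assms by (cases n) auto
  then obtain j where j: "n = Suc j" by (cases n) auto
  have "\<not> v \<le> V \<nu> (n0 + j)"
    using not_less_Least[of j "\<lambda>n. v \<le> V \<nu> (n0 + n)"] j n_def by simp
  then show thesis using n j by (intro that[of j]) auto
qed

text \<open>The function $g(v) = \mathrm{kern}(c v)\, v^{\<sigma>-1}$ is strictly decreasing since
  $\<sigma> \<le> 1$. On $(V_n, V_{n+1}]$ it lies strictly below $g(V_n)$, and there
  $\<nu>_{n+1} \<le> \<nu>_n$ and $g(V_n) \<le> g(\widetilde V_n)$ once $n \<ge> n_0$. So the sum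
  exceeds the integral of $g$ over $(V_{n_0}, \<infinity>)$; the missing initial piece of the
  integral is the origin of $\<theta>$.\<close>

lemma weight_sum_greater:
  assumes c: "0 < c"
  shows "ennreal (c powr (- \<sigma>) * (LBINT t:{c * V \<nu> n0<..}. ker t * t powr (\<sigma> - 1)))
    < (\<Sum>n. ennreal (\<nu> (Suc n) * W (Suc n) powr (\<sigma> - 1) * ker (c * W (Suc n))))"
proof -
  define g where "g v = ker (c * v) * v powr (\<sigma> - 1)" for v
  have g_pos: "g v > 0" if "v > 0" for v
    using that c ker_pos by (simp add: g_def)
  have g_less: "g w < g v" if "0 < v" "v < w" for v w
  proof -
    have "ker (c * w) < ker (c * v)" using that c by (intro ker_strict_antimono) auto
    moreover have "w powr (\<sigma> - 1) \<le> v powr (\<sigma> - 1)" using that sigma_le by (intro powr_mono2') auto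
    moreover have "0 < ker (c * w)" using that c by (intro ker_pos) auto
    ultimately show ?thesis unfolding g_def using that by (intro mult_less_le_imp_less) auto
  qed
  have Vn0: "V \<nu> n0 > 0" using V_pos n0 by simp
  let ?M = "lebesgue_on {V \<nu> n0<..}"
  let ?G = "\<lambda>v. \<Sum>n. ennreal (g (V \<nu> (n0 + n))) * indicator {V \<nu> (n0 + n)<..V \<nu> (Suc (n0 + n))} v"
  have ind: "(indicator {V \<nu> (n0 + n)<..V \<nu> (Suc (n0 + n))} :: real \<Rightarrow> ennreal) \<in> borel_measurable ?M" for n
    by (intro measurable_restrict_space1 borel_measurable_indicator) auto
  have "ennreal (c powr (- \<sigma>) * (LBINT t:{c * V \<nu> n0<..}. ker t * t powr (\<sigma> - 1)))
      = (\<integral>\<^sup>+v. ennreal (g v) \<partial>?M)"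
    unfolding g_def by (rule nn_integral_kern_tail[OF alpha rho gamma gamma_less c Vn0, symmetric])
  also have "\<dots> < (\<integral>\<^sup>+v. ?G v \<partial>?M)"
  proof (rule nn_integral_less_greaterThan)
    show "(\<lambda>v. ennreal (g v)) \<in> borel_measurable ?M"
    proof -
      have "continuous_on {V \<nu> n0<..} (\<lambda>v. ker (c * v))"
        by (rule continuous_on_compose2[OF ker_continuous])
          (use c Vn0 in \<open>auto intro!: continuous_intros mult_pos_pos\<close>)
      then have "continuous_on {V \<nu> n0<..} g"
        unfolding g_def using Vn0 by (intro continuous_intros) auto
      then show ?thesis
        by (intro measurable_compose[OF _ measurable_ennreal] continuous_imp_measurable_on_sets_lebesgue) auto
    qed
    show "?G \<in> borel_measurable ?M"
      using ind by measurable
    show "(\<integral>\<^sup>+v. ennreal (g v) \<partial>?M) \<noteq> \<infinity>"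
      unfolding g_def by (subst nn_integral_kern_tail[OF alpha rho gamma gamma_less c Vn0]) simp
    show "ennreal (g v) < ?G v" if "V \<nu> n0 < v" for v
    proof -
      obtain n where n: "V \<nu> (n0 + n) < v" "v \<le> V \<nu> (Suc (n0 + n))" using V_interval[OF \<open>V \<nu> n0 < v\<close>] .
      have pos: "0 < V \<nu> (n0 + n)" using n0 by (intro V_pos) auto
      have "ennreal (g v) < ennreal (g (V \<nu> (n0 + n))) * indicator {V \<nu> (n0 + n)<..V \<nu> (Suc (n0 + n))} v"
        using n g_less[OF pos n(1)] g_pos[OF pos] by (simp add: ennreal_lessI)
      also have "\<dots> \<le> ?G v"
        by (rule ennreal_le_suminf)
      finally show ?thesis .
    qed
  qed
  also have "\<dots> = (\<Sum>n. \<integral>\<^sup>+v. ennreal (g (V \<nu> (n0 + n))) * indicator {V \<nu> (n0 + n)<..V \<nu> (Suc (n0 + n))} v \<partial>?M)"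
    using ind by (intro nn_integral_suminf borel_measurable_times) auto
  also have "\<dots> = (\<Sum>n. ennreal (g (V \<nu> (n0 + n)) * \<nu> (Suc (n0 + n))))"
  proof (intro suminf_cong)
    fix n
    let ?I = "{V \<nu> (n0 + n)<..V \<nu> (Suc (n0 + n))}"
    have sub: "?I \<subseteq> {V \<nu> n0<..}" using V_mono[of n0 "n0 + n"] by auto
    have "?I = {V \<nu> n0<..} \<inter> ?I" using sub by auto
    then have "?I \<in> sets ?M" by (auto simp: sets_restrict_space)
    then have "(\<integral>\<^sup>+v. ennreal (g (V \<nu> (n0 + n))) * indicator ?I v \<partial>?M) = ennreal (g (V \<nu> (n0 + n))) * emeasure ?M ?I"
      by (intro nn_integral_cmult_indicator)
    also have "emeasure ?M ?I = ennreal (\<nu> (Suc (n0 + n)))"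
      using sub nu_pos[of "Suc (n0 + n)"] by (simp add: emeasure_restrict_space V_Suc)
    finally show "(\<integral>\<^sup>+v. ennreal (g (V \<nu> (n0 + n))) * indicator ?I v \<partial>?M) = ennreal (g (V \<nu> (n0 + n)) * \<nu> (Suc (n0 + n)))"
      using nu_pos[of "Suc (n0 + n)"] by (simp add: ennreal_mult'')
  qed
  also have "\<dots> \<le> (\<Sum>n. ennreal (\<nu> (n0 + n) * W (n0 + n) powr (\<sigma> - 1) * ker (c * W (n0 + n))))"
  proof (intro suminf_le ennreal_leI summableI)
    fix n
    have n: "1 \<le> n0 + n" using n0 by simp
    have "g (V \<nu> (n0 + n)) * \<nu> (Suc (n0 + n)) \<le> g (V \<nu> (n0 + n)) * \<nu> (n0 + n)"
      using g_pos[OF V_pos[OF n]] nu_decr[of "n0 + n"] by (intro mult_left_mono) auto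
    also have "\<dots> \<le> g (W (n0 + n)) * \<nu> (n0 + n)"
      using g_less[OF W_pos[OF n], of "V \<nu> (n0 + n)"] W_le[OF n] nu_pos[OF n]
      by (intro mult_right_mono) (auto simp: le_less)
    finally show "g (V \<nu> (n0 + n)) * \<nu> (Suc (n0 + n))
        \<le> \<nu> (n0 + n) * W (n0 + n) powr (\<sigma> - 1) * ker (c * W (n0 + n))"
      by (simp add: g_def mult_ac)
  qed
  also have "\<dots> \<le> (\<Sum>n. ennreal (\<nu> (Suc n) * W (Suc n) powr (\<sigma> - 1) * ker (c * W (Suc n))))"
  proof -
    let ?f = "\<lambda>n. ennreal (\<nu> (Suc n) * W (Suc n) powr (\<sigma> - 1) * ker (c * W (Suc n)))"
    obtain m where m: "n0 = Suc m" using n0 by (cases n0) auto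
    have "suminf ?f = (\<Sum>n. ?f (n + m)) + sum ?f {..<m}"
      by (rule suminf_offset[OF summableI])
    then show ?thesis by (simp add: m add.commute)
  qed
  finally show ?thesis .
qed

lemma one_minus_theta:
  assumes "x > 0"
  shows "1 - th x = (LBINT t:{U \<mu> x powr \<delta> * V \<nu> n0<..}. ker t * t powr (\<sigma> - 1)) / kk \<sigma>"
proof -
  have "0 \<le> U \<mu> x powr \<delta> * V \<nu> n0" using V_pos[of n0] n0 by simp
  then show ?thesis
    using k_split[OF alpha rho gamma gamma_less, of "U \<mu> x powr \<delta> * V \<nu> n0"]
      k_pos[OF alpha rho gamma gamma_less] by (simp add: \<theta>_def field_simps)
qed

lemma theta_less_1: "x > 0 \<Longrightarrow> 0 < 1 - th x"
  using one_minus_theta[of x] k_pos[OF alpha rho gamma gamma_less] V_pos[of n0] n0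
    set_lebesgue_integral_kern_pos[OF alpha rho gamma gamma_less, of "U \<mu> x powr \<delta> * V \<nu> n0"] by simp

lemma theta_nonneg: "0 \<le> th x"
proof -
  have "0 \<le> (LBINT t:{0<..U \<mu> x powr \<delta> * V \<nu> n0}. ker t * t powr (\<sigma> - 1))"
    unfolding set_lebesgue_integral_def using ker_pos
    by (intro integral_nonneg_AE AE_I2) (auto simp: indicator_def less_imp_le)
  then show ?thesis using k_pos[OF alpha rho gamma gamma_less] by (simp add: \<theta>_def)
qed

lemma weight_greater:
  assumes "x > 0"
  shows "ennreal (kk \<sigma> * (1 - th x) * U \<mu> x powr (- \<delta> * \<sigma>))
    < (\<Sum>n. ennreal (\<nu> (Suc n) * W (Suc n) powr (\<sigma> - 1) * h x (Suc n)))"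
  using weight_sum_greater[of "U \<mu> x powr \<delta>"] U_pos[OF assms] one_minus_theta[OF assms]
    k_pos[OF alpha rho gamma gamma_less]
  by (simp add: powr_powr H_def mult.commute)

section \<open>Measurability and weights\<close>

lemma U_measurable [measurable]: "U \<mu> \<in> borel_measurable R"
  using U_continuous by (intro continuous_imp_measurable_on_sets_lebesgue) auto

lemma mu_measurable [measurable]: "\<mu> \<in> borel_measurable R"
  using mu_cont by (intro continuous_imp_measurable_on_sets_lebesgue) auto

lemma h_measurable [measurable]: "(\<lambda>x. h x (Suc n)) \<in> borel_measurable R"
proof -
  have nz: "U \<mu> x \<noteq> 0" if "x > 0" for x using U_pos[OF that] by simp
  have "continuous_on {0<..} (\<lambda>x. U \<mu> x powr \<delta> * W (Suc n))"
    by (intro continuous_intros U_continuous) (auto dest: nz)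
  then have "continuous_on {0<..} (\<lambda>x. h x (Suc n))"
    unfolding H_def using W_pos[of "Suc n"]
    by (intro continuous_on_compose2[OF ker_continuous]) (auto intro!: mult_pos_pos dest: nz)
  then show ?thesis by (intro continuous_imp_measurable_on_sets_lebesgue) auto
qed

lemma th_measurable [measurable]: "th \<in> borel_measurable R"
proof -
  let ?G = "\<lambda>a. LBINT t:{0<..a}. ker t * t powr (\<sigma> - 1)"
  have "mono ?G"
  proof (rule monoI)
    fix a b :: real assume "a \<le> b"
    have int: "set_integrable lborel {0<..c} (\<lambda>t. ker t * t powr (\<sigma> - 1))" for c
      by (rule set_integrable_kern_powr[OF alpha rho gamma gamma_less]) auto
    show "?G a \<le> ?G b"
      unfolding set_lebesgue_integral_def
      using int[of a] int[of b] \<open>a \<le> b\<close> ker_pos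
      by (intro integral_mono) (auto simp: set_integrable_def indicator_def less_imp_le)
  qed
  then have [measurable]: "?G \<in> borel_measurable borel" by (rule borel_measurable_mono)
  have "(\<lambda>x. 1 / kk \<sigma> * ?G (U \<mu> x powr \<delta> * V \<nu> n0)) \<in> borel_measurable R"
    by (intro borel_measurable_times borel_measurable_const measurable_compose[OF _ \<open>?G \<in> borel_measurable borel\<close>])
      measurable
  then show ?thesis by (simp add: \<theta>_def[abs_def])
qed

lemma h_pos: "x > 0 \<Longrightarrow> h x (Suc n) > 0"
  unfolding H_def using U_pos[of x] W_pos[of "Suc n"] by (intro ker_pos) auto

lemma kk_pos: "kk \<sigma> > 0"
  by (rule k_pos[OF alpha rho gamma gamma_less])

text \<open>The density for which the integral of $H_\<delta>(\cdot, n)$ is exact.\<close>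

definition w :: "real \<Rightarrow> real" where "w x = U \<mu> x powr (\<delta> * \<sigma> - 1) * \<mu> x"

lemma w_pos: "x > 0 \<Longrightarrow> w x > 0"
  using U_pos[of x] mu_pos[of x] by (simp add: w_def)

lemma w_measurable [measurable]: "w \<in> borel_measurable R"
  unfolding w_def[abs_def] by measurable

lemma nn_integral_h_w: "(\<integral>\<^sup>+x. ennreal (h x (Suc n) * w x) \<partial>R) = ennreal (W (Suc n) powr (- \<sigma>) * kk \<sigma>)"
  using nn_integral_kern_U[OF gamma_less W_pos[of "Suc n"]] by (simp add: H_def w_def mult_ac)

lemma Phi_eq:
  assumes "x > 0"
  shows "\<Phi> \<delta> \<mu> \<sigma> p x = U \<mu> x powr (- \<delta> * \<sigma>) * w x powr (1 - p)"
proof -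
  have "U \<mu> x powr (- \<delta> * \<sigma>) * w x powr (1 - p)
    = (U \<mu> x powr (- \<delta> * \<sigma>) * U \<mu> x powr ((\<delta> * \<sigma> - 1) * (1 - p))) * \<mu> x powr (1 - p)"
    using assms U_pos[of x] mu_pos[of x] by (simp add: w_def powr_mult powr_powr)
  also have "\<dots> = U \<mu> x powr (p * (1 - \<delta> * \<sigma>) - 1) * \<mu> x powr (1 - p)"
    by (simp add: algebra_simps flip: powr_add)
  also have "\<dots> = \<Phi> \<delta> \<mu> \<sigma> p x"
    using mu_pos[OF assms] by (simp add: \<Phi>_def powr_diff divide_simps)
  finally show ?thesis by simp
qed

lemma Phi_pos: "x > 0 \<Longrightarrow> \<Phi> \<delta> \<mu> \<sigma> p x > 0"
  using Phi_eq[of x] U_pos[of x] w_pos[of x] by simp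

lemma Phi_measurable [measurable]: "\<Phi> \<delta> \<mu> \<sigma> p \<in> borel_measurable R"
  unfolding \<Phi>_def[abs_def] by measurable

abbreviation "Ph \<equiv> \<Phi> \<delta> \<mu> \<sigma> p"
abbreviation "Pt \<equiv> \<Phi>t \<alpha> \<rho> \<gamma> \<delta> \<mu> \<nu> n0 \<sigma> p"
abbreviation "Ps \<equiv> \<Psi>t \<nu> \<nu>t \<sigma> q"

lemma Pt_measurable [measurable]: "Pt \<in> borel_measurable R"
  unfolding \<Phi>t_def[abs_def] by measurable

lemma Pt_pos: "x > 0 \<Longrightarrow> Pt x > 0"
  using Phi_pos[of x] theta_less_1[of x] by (simp add: \<Phi>t_def)

lemma Pt_le: "x > 0 \<Longrightarrow> Pt x \<le> Ph x"
  using Phi_pos[of x] theta_nonneg[of x] by (simp add: \<Phi>t_def algebra_simps)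

lemma Psi_pos: "Ps (Suc n) > 0"
  using W_pos[of "Suc n"] nu_pos[of "Suc n"] by (simp add: \<Psi>t_def)

text \<open>The exponents are conjugate: $q(1-p) = -p$ and $(1-q)(1-p) = 1$.\<close>

lemma Psi_powr: "Ps (Suc n) powr (1 - p) = \<nu> (Suc n) / W (Suc n) powr (1 - p * \<sigma>)"
proof -
  have *: "W (Suc n) > 0" "\<nu> (Suc n) > 0" using W_pos nu_pos by auto
  have "(q * (1 - \<sigma>) - 1) * (1 - p) = q * (1 - p) * (1 - \<sigma>) - (1 - p)"
    by (simp add: algebra_simps)
  also have "\<dots> = - (1 - p * \<sigma>)"
    unfolding exponents by (simp add: algebra_simps)
  finally have "(q * (1 - \<sigma>) - 1) * (1 - p) = - (1 - p * \<sigma>)" .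
  moreover have "(1 - q) * (1 - p) = 1" by (rule exponents)
  moreover have "Ps (Suc n) = W (Suc n) powr (q * (1 - \<sigma>) - 1) * \<nu> (Suc n) powr (1 - q)"
    using * by (simp add: \<Psi>t_def powr_diff divide_simps)
  ultimately show ?thesis using *
    by (simp add: powr_mult powr_powr powr_minus divide_simps) (simp flip: powr_add)
qed

lemma Psi_eq:
  "Ps (Suc n) = (\<nu> (Suc n) * W (Suc n) powr (\<sigma> - 1)) powr (1 - q) * W (Suc n) powr (- \<sigma>)"
proof -
  have *: "W (Suc n) > 0" "\<nu> (Suc n) > 0" using W_pos nu_pos by auto
  have "(\<nu> (Suc n) * W (Suc n) powr (\<sigma> - 1)) powr (1 - q) * W (Suc n) powr (- \<sigma>)
    = \<nu> (Suc n) powr (1 - q) * (W (Suc n) powr ((\<sigma> - 1) * (1 - q)) * W (Suc n) powr (- \<sigma>))"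
    using * by (simp add: powr_mult powr_powr)
  also have "\<dots> = \<nu> (Suc n) powr (1 - q) * W (Suc n) powr (q * (1 - \<sigma>) - 1)"
    by (simp add: algebra_simps flip: powr_add)
  finally show ?thesis using * by (simp add: \<Psi>t_def powr_diff divide_simps)
qed

section \<open>Admissible functions and sequences\<close>

text \<open>Admissibility of a pair splits into one condition on $f$ and one on $a$. They are
  stated with real powers and without the outer exponents $1/p$ and $1/q$. For the sequence, finiteness
  of a sum of negative powers forces every term to be positive.\<close>

definition adm_fun :: "(real \<Rightarrow> real) \<Rightarrow> bool" where
  "adm_fun f \<longleftrightarrow> f \<in> borel_measurable R \<and> (\<forall>x>0. f x \<ge> 0) \<and>
    0 < (\<integral>\<^sup>+x. ennreal (Ph x * f x powr p) \<partial>R) \<and> (\<integral>\<^sup>+x. ennreal (Ph x * f x powr p) \<partial>R) < \<infinity>"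

definition adm_seq :: "(nat \<Rightarrow> real) \<Rightarrow> bool" where
  "adm_seq a \<longleftrightarrow> (\<forall>n. a (Suc n) > 0) \<and>
    0 < (\<Sum>n. ennreal (Ps (Suc n) * a (Suc n) powr q)) \<and> (\<Sum>n. ennreal (Ps (Suc n) * a (Suc n) powr q)) < \<infinity>"

lemma fun_norm_eq:
  assumes "\<And>x. x > 0 \<Longrightarrow> f x \<ge> 0" "\<And>x. x > 0 \<Longrightarrow> \<phi> x \<ge> 0"
  shows "fun_norm p \<phi> f = epow (\<integral>\<^sup>+x. ennreal (\<phi> x * f x powr p) \<partial>R) (1 / p)"
  unfolding fun_norm_def using assms p(1)
  by (intro arg_cong[where f = "\<lambda>z. epow z (1 / p)"] nn_integral_cong) (simp add: epow_ennreal' ennreal_mult)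

lemma seq_norm_eq:
  assumes "\<And>n. a (Suc n) > 0"
  shows "seq_norm q Ps a = epow (\<Sum>n. ennreal (Ps (Suc n) * a (Suc n) powr q)) (1 / q)"
  unfolding seq_norm_def using assms Psi_pos
  by (intro arg_cong[where f = "\<lambda>z. epow z (1 / q)"] suminf_cong) (simp add: epow_ennreal ennreal_mult less_imp_le)

lemma adm_fun_iff:
  "adm_fun f \<longleftrightarrow> f \<in> borel_measurable R \<and> (\<forall>x>0. f x \<ge> 0) \<and> 0 < fun_norm p Ph f \<and> fun_norm p Ph f < \<infinity>"
proof (cases "\<forall>x>0. f x \<ge> 0")
  case True
  then have "fun_norm p Ph f = epow (\<integral>\<^sup>+x. ennreal (Ph x * f x powr p) \<partial>R) (1 / p)"
    by (intro fun_norm_eq) (auto simp: Phi_pos less_imp_le)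
  then show ?thesis
    using True p epow_pos_finite_iff[of "1 / p" "\<integral>\<^sup>+x. ennreal (Ph x * f x powr p) \<partial>R"]
    by (simp add: adm_fun_def)
qed (auto simp: adm_fun_def)

lemma adm_seq_iff:
  "adm_seq a \<longleftrightarrow> (\<forall>n. a (Suc n) \<ge> 0) \<and> 0 < seq_norm q Ps a \<and> seq_norm q Ps a < \<infinity>"
proof (cases "\<forall>n. a (Suc n) > 0")
  case True
  then show ?thesis
    using q_neg epow_pos_finite_iff[of "1 / q" "\<Sum>n. ennreal (Ps (Suc n) * a (Suc n) powr q)"]
    by (simp add: adm_seq_def seq_norm_eq less_imp_le)
next
  case False
  then obtain n where n: "\<not> a (Suc n) > 0" by blast
  have "seq_norm q Ps a = 0" if "a (Suc n) = 0"
  proof -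
    have "ennreal (Ps (Suc n)) * epow (ennreal (a (Suc n))) q = top"
      using that q_neg Psi_pos[of n] by (simp add: ennreal_mult_top)
    then have "(\<Sum>n. ennreal (Ps (Suc n)) * epow (ennreal (a (Suc n))) q) = top"
      using ennreal_le_suminf[of "\<lambda>n. ennreal (Ps (Suc n)) * epow (ennreal (a (Suc n))) q" n]
      by (simp add: top_unique)
    then show ?thesis using q_neg by (simp add: seq_norm_def)
  qed
  then have "\<not> (0 \<le> a (Suc n) \<and> 0 < seq_norm q Ps a)"
    using n by (cases "a (Suc n) = 0") auto
  then show ?thesis using False by (auto simp: adm_seq_def)
qed

lemma admissible_iff: "admissible \<delta> \<mu> \<nu> \<nu>t \<sigma> p q f a \<longleftrightarrow> adm_fun f \<and> adm_seq a"
proof -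
  have "(\<forall>n\<ge>1. a n \<ge> 0) \<longleftrightarrow> (\<forall>n. a (Suc n) \<ge> 0)"
    by (metis One_nat_def Suc_le_D Suc_le_mono zero_le)
  then show ?thesis by (auto simp: admissible_def adm_fun_iff adm_seq_iff)
qed

lemma Pt_integral_pos_finite:
  assumes "adm_fun f"
  shows "0 < (\<integral>\<^sup>+x. ennreal (Pt x * f x powr p) \<partial>R)" "(\<integral>\<^sup>+x. ennreal (Pt x * f x powr p) \<partial>R) < \<infinity>"
proof -
  have [measurable]: "f \<in> borel_measurable R" using assms by (simp add: adm_fun_def)
  have "(\<integral>\<^sup>+x. ennreal (Pt x * f x powr p) \<partial>R) \<le> (\<integral>\<^sup>+x. ennreal (Ph x * f x powr p) \<partial>R)"
    using Pt_le by (intro nn_integral_mono ennreal_leI mult_right_mono) auto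
  then show "(\<integral>\<^sup>+x. ennreal (Pt x * f x powr p) \<partial>R) < \<infinity>"
    using assms by (auto simp: adm_fun_def)
  show "0 < (\<integral>\<^sup>+x. ennreal (Pt x * f x powr p) \<partial>R)"
  proof (rule ccontr)
    assume "\<not> ?thesis"
    then have "AE x in R. ennreal (Pt x * f x powr p) = 0"
      by (subst nn_integral_0_iff_AE[symmetric]) auto
    moreover have "AE x in R. x > 0" by (intro AE_I2) simp
    ultimately have "AE x in R. ennreal (Ph x * f x powr p) = 0"
    proof eventually_elim
      case (elim x)
      then have "f x = 0" using Pt_pos[of x] by (auto simp: ennreal_eq_0_iff mult_le_0_iff)
      then show ?case using p by simp
    qed
    then have "(\<integral>\<^sup>+x. ennreal (Ph x * f x powr p) \<partial>R) = 0"
      by (subst nn_integral_0_iff_AE) auto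
    then show False using assms by (simp add: adm_fun_def)
  qed
qed

section \<open>The three inequalities\<close>

abbreviation "lhs2_sum f \<equiv> (\<Sum>n. ennreal (\<nu> (Suc n) / W (Suc n) powr (1 - p * \<sigma>)) *
       epow (\<integral>\<^sup>+x. ennreal (h x (Suc n) * f x) \<partial>R) p)"

abbreviation "lhs3_weight x \<equiv> (1 - th x) powr (1 - q) * \<mu> x / U \<mu> x powr (1 - q * \<delta> * \<sigma>)"

abbreviation "lhs3_int a \<equiv> (\<integral>\<^sup>+x. ennreal (lhs3_weight x) * epow (\<Sum>n. ennreal (h x (Suc n) * a (Suc n))) q \<partial>R)"

text \<open>The Hoelder inequality in $x$, with $A = H f$ and $B = H w$, bounds each
  $(\int H f)^p$ from below by a multiple of $\int H f^p w^{1-p}$, because $\int B$ is known exactly.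
  Summing over $n$ produces the weight sum, and its strict lower bound gives $\widetilde\<Phi>_\<delta>$.
  Strictness survives the integration since $f$ does not vanish almost everywhere.\<close>

lemma lhs2_greater:
  assumes f: "adm_fun f"
  shows "ennreal (kk \<sigma>) * fun_norm p Pt f < lhs2 h \<nu> \<nu>t \<sigma> p f"
proof -
  have fm [measurable]: "f \<in> borel_measurable R" and f0: "\<And>x. x > 0 \<Longrightarrow> f x \<ge> 0"
    using f by (auto simp: adm_fun_def)
  let ?b = "\<lambda>x. w x powr (1 - p) * f x powr p"
  let ?om = "\<lambda>x. \<Sum>n. ennreal (\<nu> (Suc n) * W (Suc n) powr (\<sigma> - 1) * h x (Suc n))"
  let ?I = "\<integral>\<^sup>+x. ennreal (Pt x * f x powr p) \<partial>R"
  have nW: "\<nu> (Suc n) > 0" "W (Suc n) > 0" for n using nu_pos W_pos by auto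
  have Pt: "kk \<sigma> * Pt x * f x powr p = ?b x * (kk \<sigma> * (1 - th x) * U \<mu> x powr (- \<delta> * \<sigma>))" if "x > 0" for x
    by (simp add: \<Phi>t_def Phi_eq[OF that] mult_ac)
  have le: "(\<integral>\<^sup>+x. ennreal (\<nu> (Suc n) * W (Suc n) powr (\<sigma> - 1) * h x (Suc n) * ?b x) \<partial>R)
    \<le> ennreal (kk \<sigma> powr (1 - p)) * (ennreal (\<nu> (Suc n) / W (Suc n) powr (1 - p * \<sigma>)) *
       epow (\<integral>\<^sup>+x. ennreal (h x (Suc n) * f x) \<partial>R) p)" for n
  proof -
    let ?c = "\<nu> (Suc n) * W (Suc n) powr (\<sigma> - 1)"
    have "(\<integral>\<^sup>+x. ennreal (h x (Suc n) * ?b x) \<partial>R)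
      = (\<integral>\<^sup>+x. epow (ennreal (h x (Suc n) * f x)) p * epow (ennreal (h x (Suc n) * w x)) (1 - p) \<partial>R)"
    proof (intro nn_integral_cong)
      fix x assume "x \<in> space R"
      then have x: "x > 0" by simp
      have "(h x (Suc n) * f x) powr p * (h x (Suc n) * w x) powr (1 - p)
        = (h x (Suc n) powr p * h x (Suc n) powr (1 - p)) * ?b x"
        using h_pos[OF x, of n] f0[OF x] w_pos[OF x] by (simp add: powr_mult)
      also have "\<dots> = h x (Suc n) * ?b x"
        using h_pos[OF x, of n] by (simp flip: powr_add)
      finally show "ennreal (h x (Suc n) * ?b x) =
          epow (ennreal (h x (Suc n) * f x)) p * epow (ennreal (h x (Suc n) * w x)) (1 - p)"
        using h_pos[OF x, of n] f0[OF x] w_pos[OF x] p by (simp add: epow_ennreal' flip: ennreal_mult)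
    qed
    also have "\<dots> \<le> epow (\<integral>\<^sup>+x. ennreal (h x (Suc n) * f x) \<partial>R) p * epow (\<integral>\<^sup>+x. ennreal (h x (Suc n) * w x) \<partial>R) (1 - p)"
      by (intro nn_integral_Holder p) measurable
    also have "epow (\<integral>\<^sup>+x. ennreal (h x (Suc n) * w x) \<partial>R) (1 - p) = ennreal ((W (Suc n) powr (- \<sigma>) * kk \<sigma>) powr (1 - p))"
      using nW[of n] kk_pos by (simp add: nn_integral_h_w epow_ennreal)
    finally have holder: "(\<integral>\<^sup>+x. ennreal (h x (Suc n) * ?b x) \<partial>R)
      \<le> epow (\<integral>\<^sup>+x. ennreal (h x (Suc n) * f x) \<partial>R) p * ennreal ((W (Suc n) powr (- \<sigma>) * kk \<sigma>) powr (1 - p))" .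
    have "(\<integral>\<^sup>+x. ennreal (?c * h x (Suc n) * ?b x) \<partial>R) = (\<integral>\<^sup>+x. ennreal ?c * ennreal (h x (Suc n) * ?b x) \<partial>R)"
      using nW[of n] by (intro nn_integral_cong) (simp add: mult.assoc flip: ennreal_mult')
    also have "\<dots> = ennreal ?c * (\<integral>\<^sup>+x. ennreal (h x (Suc n) * ?b x) \<partial>R)"
      by (intro nn_integral_cmult) measurable
    also have "\<dots> \<le> ennreal ?c * (epow (\<integral>\<^sup>+x. ennreal (h x (Suc n) * f x) \<partial>R) p * ennreal ((W (Suc n) powr (- \<sigma>) * kk \<sigma>) powr (1 - p)))"
      by (intro mult_left_mono holder) auto
    also have "\<dots> = ennreal (?c * (W (Suc n) powr (- \<sigma>) * kk \<sigma>) powr (1 - p)) * epow (\<integral>\<^sup>+x. ennreal (h x (Suc n) * f x) \<partial>R) p"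
      using nW[of n] by (simp add: ennreal_mult mult_ac)
    also have "?c * (W (Suc n) powr (- \<sigma>) * kk \<sigma>) powr (1 - p)
        = kk \<sigma> powr (1 - p) * \<nu> (Suc n) * (W (Suc n) powr (\<sigma> - 1) * W (Suc n) powr (- \<sigma> * (1 - p)))"
      using nW[of n] kk_pos by (simp add: powr_mult powr_powr)
    also have "W (Suc n) powr (\<sigma> - 1) * W (Suc n) powr (- \<sigma> * (1 - p)) = W (Suc n) powr (- (1 - p * \<sigma>))"
      by (simp add: algebra_simps flip: powr_add)
    also have "kk \<sigma> powr (1 - p) * \<nu> (Suc n) * W (Suc n) powr (- (1 - p * \<sigma>))
        = kk \<sigma> powr (1 - p) * (\<nu> (Suc n) / W (Suc n) powr (1 - p * \<sigma>))"
      using nW[of n] by (simp only: powr_minus) (simp add: divide_simps)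
    finally show ?thesis using nW[of n] by (simp add: ennreal_mult mult.assoc del: times_divide_eq_right)
  qed
  have "ennreal (kk \<sigma>) * ?I = (\<integral>\<^sup>+x. ennreal (kk \<sigma> * Pt x * f x powr p) \<partial>R)"
    using kk_pos by (subst nn_integral_cmult[symmetric]) (auto simp: mult.assoc simp flip: ennreal_mult')
  also have "\<dots> < (\<integral>\<^sup>+x. ennreal (?b x) * ?om x \<partial>R)"
  proof (rule nn_integral_less)
    show "(\<integral>\<^sup>+x. ennreal (kk \<sigma> * Pt x * f x powr p) \<partial>R) \<noteq> \<infinity>"
      using Pt_integral_pos_finite(2)[OF f] calculation by (auto simp: ennreal_mult_eq_top_iff)
    have lt: "ennreal (kk \<sigma> * Pt x * f x powr p) < ennreal (?b x) * ?om x" if "x > 0" "f x \<noteq> 0" for x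
    proof -
      have b: "?b x > 0" using that w_pos[of x] by simp
      have "ennreal (kk \<sigma> * Pt x * f x powr p) = ennreal (?b x) * ennreal (kk \<sigma> * (1 - th x) * U \<mu> x powr (- \<delta> * \<sigma>))"
        unfolding Pt[OF that(1)] using b by (simp add: ennreal_mult')
      also have "\<dots> < ennreal (?b x) * ?om x"
        using b weight_greater[OF that(1)] by (intro ennreal_mult_strict_left_mono) auto
      finally show ?thesis .
    qed
    show "AE x in R. ennreal (kk \<sigma> * Pt x * f x powr p) \<le> ennreal (?b x) * ?om x"
    proof (intro AE_I2)
      fix x assume "x \<in> space R"
      then show "ennreal (kk \<sigma> * Pt x * f x powr p) \<le> ennreal (?b x) * ?om x"
        using lt[of x] p by (cases "f x = 0") (auto simp: less_imp_le)
    qed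
    show "\<not> (AE x in R. ennreal (?b x) * ?om x \<le> ennreal (kk \<sigma> * Pt x * f x powr p))"
    proof
      assume "AE x in R. ennreal (?b x) * ?om x \<le> ennreal (kk \<sigma> * Pt x * f x powr p)"
      moreover have "AE x in R. x > 0" by (intro AE_I2) simp
      ultimately have "AE x in R. ennreal (Ph x * f x powr p) = 0"
      proof eventually_elim
        case (elim x)
        then have "f x = 0" using lt[of x] by (auto simp: not_le[symmetric])
        then show ?case using p by simp
      qed
      then have "(\<integral>\<^sup>+x. ennreal (Ph x * f x powr p) \<partial>R) = 0"
        by (subst nn_integral_0_iff_AE) auto
      then show False using f by (simp add: adm_fun_def)
    qed
  qed measurable
  also have "\<dots> = (\<integral>\<^sup>+x. (\<Sum>n. ennreal (\<nu> (Suc n) * W (Suc n) powr (\<sigma> - 1) * h x (Suc n) * ?b x)) \<partial>R)"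
  proof (intro nn_integral_cong)
    fix x assume "x \<in> space R"
    then have x: "x > 0" by simp
    have "ennreal (?b x) * ?om x = (\<Sum>n. ennreal (?b x) * ennreal (\<nu> (Suc n) * W (Suc n) powr (\<sigma> - 1) * h x (Suc n)))"
      by simp
    also have "\<dots> = (\<Sum>n. ennreal (\<nu> (Suc n) * W (Suc n) powr (\<sigma> - 1) * h x (Suc n) * ?b x))"
      using w_pos[OF x] by (intro suminf_cong) (simp add: mult_ac flip: ennreal_mult')
    finally show "ennreal (?b x) * ?om x = \<dots>" .
  qed
  also have "\<dots> = (\<Sum>n. \<integral>\<^sup>+x. ennreal (\<nu> (Suc n) * W (Suc n) powr (\<sigma> - 1) * h x (Suc n) * ?b x) \<partial>R)"
    by (intro nn_integral_suminf) measurable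
  also have "\<dots> \<le> (\<Sum>n. ennreal (kk \<sigma> powr (1 - p)) * (ennreal (\<nu> (Suc n) / W (Suc n) powr (1 - p * \<sigma>)) *
       epow (\<integral>\<^sup>+x. ennreal (h x (Suc n) * f x) \<partial>R) p))"
    by (intro suminf_le le summableI)
  also have "\<dots> = ennreal (kk \<sigma> powr (1 - p)) * lhs2_sum f"
    by simp
  finally have "ennreal (kk \<sigma>) * ?I < ennreal (kk \<sigma> powr (1 - p)) * lhs2_sum f" .
  then have "ennreal (kk \<sigma> powr (p - 1)) * (ennreal (kk \<sigma>) * ?I)
      < ennreal (kk \<sigma> powr (p - 1)) * (ennreal (kk \<sigma> powr (1 - p)) * lhs2_sum f)"
    using kk_pos by (intro ennreal_mult_strict_left_mono) auto
  moreover have "kk \<sigma> powr (p - 1) * kk \<sigma> = kk \<sigma> powr p" "kk \<sigma> powr (p - 1) * kk \<sigma> powr (1 - p) = 1"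
    using kk_pos by (simp_all add: powr_diff flip: powr_add)
  ultimately have "ennreal (kk \<sigma> powr p) * ?I < lhs2_sum f"
    using kk_pos by (simp add: mult.assoc[symmetric] flip: ennreal_mult')
  then have "epow (ennreal (kk \<sigma> powr p) * ?I) (1 / p) < epow (lhs2_sum f) (1 / p)"
    using p by (intro epow_strict_mono) auto
  then show ?thesis
    using kk_pos p f0 by (simp add: epow_mult_real powr_powr lhs2_def fun_norm_eq Pt_pos less_imp_le)
qed

text \<open>The reverse Hoelder inequality for the series $\sum_n a_n \int H f$.\<close>

lemma lhs1_ge_lhs2:
  assumes fm [measurable]: "f \<in> borel_measurable R" and a: "adm_seq a"
  shows "lhs2 h \<nu> \<nu>t \<sigma> p f * seq_norm q Ps a \<le> lhs1 h f a"
proof -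
  have apos: "a (Suc n) > 0" for n using a by (simp add: adm_seq_def)
  define F where "F n = (\<integral>\<^sup>+x. ennreal (h x (Suc n) * f x) \<partial>R)" for n
  let ?S = "\<Sum>n. ennreal (Ps (Suc n) * a (Suc n) powr q)"
  have lhs1: "lhs1 h f a = (\<Sum>n. ennreal (a (Suc n)) * F n)"
    unfolding lhs1_def F_def
  proof (intro suminf_cong)
    fix n
    have "(\<integral>\<^sup>+x. ennreal (h x (Suc n) * a (Suc n) * f x) \<partial>R) = (\<integral>\<^sup>+x. ennreal (a (Suc n)) * ennreal (h x (Suc n) * f x) \<partial>R)"
      using apos[of n] by (intro nn_integral_cong) (simp add: mult_ac flip: ennreal_mult')
    also have "\<dots> = ennreal (a (Suc n)) * (\<integral>\<^sup>+x. ennreal (h x (Suc n) * f x) \<partial>R)"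
      by (intro nn_integral_cmult) measurable
    finally show "(\<integral>\<^sup>+x. ennreal (h x (Suc n) * a (Suc n) * f x) \<partial>R) = \<dots>" .
  qed
  have "lhs2_sum f = (\<Sum>n. epow (ennreal (a (Suc n)) * F n) p * epow (ennreal (Ps (Suc n) * a (Suc n) powr q)) (1 - p))"
  proof (intro suminf_cong)
    fix n
    have "epow (ennreal (a (Suc n)) * F n) p * epow (ennreal (Ps (Suc n) * a (Suc n) powr q)) (1 - p)
      = ennreal (a (Suc n) powr p * (Ps (Suc n) * a (Suc n) powr q) powr (1 - p)) * epow (F n) p"
    proof -
      have "epow (ennreal (Ps (Suc n) * a (Suc n) powr q)) (1 - p) = ennreal ((Ps (Suc n) * a (Suc n) powr q) powr (1 - p))"
        using apos[of n] Psi_pos[of n] by (intro epow_ennreal) auto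
      moreover have "epow (ennreal (a (Suc n)) * F n) p = ennreal (a (Suc n) powr p) * epow (F n) p"
        using apos by (rule epow_mult_real)
      ultimately show ?thesis by (simp only:) (simp add: ennreal_mult mult_ac)
    qed
    also have "a (Suc n) powr p * (Ps (Suc n) * a (Suc n) powr q) powr (1 - p) = Ps (Suc n) powr (1 - p) * (a (Suc n) powr p * a (Suc n) powr (- p))"
      using apos[of n] Psi_pos[of n] by (simp add: powr_mult powr_powr exponents)
    also have "\<dots> = \<nu> (Suc n) / W (Suc n) powr (1 - p * \<sigma>)"
      using apos[of n] by (simp add: Psi_powr flip: powr_add)
    finally show "ennreal (\<nu> (Suc n) / W (Suc n) powr (1 - p * \<sigma>)) * epow (\<integral>\<^sup>+x. ennreal (h x (Suc n) * f x) \<partial>R) p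
      = epow (ennreal (a (Suc n)) * F n) p * epow (ennreal (Ps (Suc n) * a (Suc n) powr q)) (1 - p)"
      by (simp add: F_def)
  qed
  also have "\<dots> \<le> epow (lhs1 h f a) p * epow ?S (1 - p)"
    unfolding lhs1 by (intro suminf_Holder p)
  finally have "epow (lhs2_sum f) (1 / p) \<le> epow (epow (lhs1 h f a) p * epow ?S (1 - p)) (1 / p)"
    using p by (intro epow_mono) auto
  also have "\<dots> = lhs1 h f a * epow ?S (- 1 / q)"
    using p by (simp add: epow_mult epow_epow exponents)
  finally have le: "lhs2 h \<nu> \<nu>t \<sigma> p f \<le> lhs1 h f a * epow ?S (- 1 / q)"
    by (simp add: lhs2_def)
  obtain s where s: "s > 0" "?S = ennreal s"
    using a by (cases ?S rule: epow_finite_pos_cases) (auto simp: adm_seq_def)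
  have "lhs2 h \<nu> \<nu>t \<sigma> p f * seq_norm q Ps a \<le> lhs1 h f a * epow ?S (- 1 / q) * seq_norm q Ps a"
    by (intro mult_right_mono le) auto
  also have "\<dots> = lhs1 h f a * (epow ?S (- 1 / q) * epow ?S (1 / q))"
    using apos by (simp add: seq_norm_eq mult.assoc)
  also have "epow ?S (- 1 / q) * epow ?S (1 / q) = 1"
    using s by (simp add: epow_ennreal flip: ennreal_mult powr_add)
  finally show ?thesis by simp
qed

lemma seq_norm_pos_finite:
  assumes "adm_seq a"
  shows "0 < seq_norm q Ps a" "seq_norm q Ps a < \<infinity>"
  using assms epow_pos_finite_iff[of "1 / q" "\<Sum>n. ennreal (Ps (Suc n) * a (Suc n) powr q)"] q_neg
  by (simp_all add: adm_seq_def seq_norm_eq)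

lemma fun_norm_Pt_pos_finite:
  assumes "adm_fun f"
  shows "0 < fun_norm p Pt f" "fun_norm p Pt f < \<infinity>"
  using Pt_integral_pos_finite[OF assms] epow_pos_finite_iff[of "1 / p" "\<integral>\<^sup>+x. ennreal (Pt x * f x powr p) \<partial>R"] p assms
  by (simp_all add: adm_fun_def fun_norm_eq Pt_pos less_imp_le)

lemma bound2_imp_bound1:
  assumes f: "adm_fun f" and a: "adm_seq a" and K: "ennreal K * fun_norm p Pt f < lhs2 h \<nu> \<nu>t \<sigma> p f"
  shows "ennreal K * fun_norm p Pt f * seq_norm q Ps a < lhs1 h f a"
proof -
  have "ennreal K * fun_norm p Pt f * seq_norm q Ps a < lhs2 h \<nu> \<nu>t \<sigma> p f * seq_norm q Ps a"
    using seq_norm_pos_finite[OF a] K by (intro ennreal_mult_strict_right_mono) auto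
  also have "\<dots> \<le> lhs1 h f a"
    using f a by (intro lhs1_ge_lhs2) (auto simp: adm_fun_def)
  finally show ?thesis .
qed

text \<open>Solving a Hoelder bound for the factor $Q$: raise it to the power $1 - q = 1/(1-p)$. The
  extended cases matter, because $G$ will be a series that may diverge.\<close>

lemma less_Holder_imp_epow_less:
  assumes c: "0 < c" and less: "ennreal c < epow G p * epow Q (1 - p)"
  shows "ennreal (c powr (1 - q)) * epow G q < Q"
proof (cases G rule: epow_finite_pos_cases)
  case zero
  then show ?thesis using less p by simp
next
  case top
  have "Q \<noteq> 0" using less p by auto
  then show ?thesis using top q_neg by (simp add: zero_less_iff_neq_zero)
next
  case (real g)
  note g = this
  show ?thesis
  proof (cases Q rule: epow_finite_pos_cases)
    case zero
    then show ?thesis using less p by simp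
  next
    case top
    then show ?thesis using g by (simp add: epow_ennreal flip: ennreal_mult)
  next
    case (real t)
    have "c < g powr p * t powr (1 - p)"
      using less c g real by (simp add: epow_ennreal ennreal_less_iff flip: ennreal_mult)
    then have "c powr (1 - q) < (g powr p * t powr (1 - p)) powr (1 - q)"
      using c q_neg by (intro powr_less_mono2) auto
    also have "\<dots> = g powr (p * (1 - q)) * t powr ((1 - p) * (1 - q))"
      using g real by (simp add: powr_mult powr_powr)
    also have "p * (1 - q) = - q" using pq q_neg p by (simp add: field_simps)
    also have "(1 - p) * (1 - q) = 1" using exponents by (simp add: mult.commute)
    finally have "c powr (1 - q) * g powr q < g powr (- q) * t * g powr q"
      using g real by (intro mult_strict_right_mono) auto
    also have "\<dots> = t" using g by (simp add: powr_minus)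
    finally show ?thesis using g real c by (simp add: epow_ennreal ennreal_less_iff flip: ennreal_mult)
  qed
qed

text \<open>Here the Hoelder inequality is applied for fixed $x$ to the weight sum, with $A = H a$ and
  $B = H a^q (\<nu> \widetilde V^{\<sigma>-1})^{1-q}$. The factor $(1-\<theta>)^{1-q}$ in the
  integrand cancels the power of the lower bound for the weight sum, and the remaining integral over
  $x$ is exact.\<close>

lemma lhs3_greater:
  assumes a: "adm_seq a"
  shows "ennreal (kk \<sigma>) * seq_norm q Ps a < lhs3 h th \<mu> \<delta> \<sigma> q a"
proof -
  have apos: "a (Suc n) > 0" for n using a by (simp add: adm_seq_def)
  have nW: "\<nu> (Suc n) > 0" "W (Suc n) > 0" for n using nu_pos W_pos by auto
  let ?S = "\<Sum>n. ennreal (Ps (Suc n) * a (Suc n) powr q)"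
  let ?G = "\<lambda>x. \<Sum>n. ennreal (h x (Suc n) * a (Suc n))"
  define v where "v n = \<nu> (Suc n) * W (Suc n) powr (\<sigma> - 1)" for n
  have v_pos: "v n > 0" for n using nW[of n] by (simp add: v_def)
  define d where "d n = v n powr (1 - q) * a (Suc n) powr q" for n
  have d_pos: "d n > 0" for n using v_pos[of n] apos[of n] by (simp add: d_def)
  let ?Q = "\<lambda>x. \<Sum>n. ennreal (h x (Suc n) * d n)"
  have pointwise: "ennreal (kk \<sigma> powr (1 - q)) * (ennreal (lhs3_weight x) * epow (?G x) q) < ennreal (w x) * ?Q x"
    if x: "x > 0" for x
  proof -
    let ?c = "kk \<sigma> * (1 - th x) * U \<mu> x powr (- \<delta> * \<sigma>)"
    have c: "?c > 0" using kk_pos theta_less_1[OF x] U_pos[OF x] by simp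
    have "ennreal ?c < (\<Sum>n. ennreal (v n * h x (Suc n)))"
      using weight_greater[OF x] by (simp add: v_def)
    also have "\<dots> = (\<Sum>n. epow (ennreal (h x (Suc n) * a (Suc n))) p * epow (ennreal (h x (Suc n) * d n)) (1 - p))"
    proof (intro suminf_cong)
      fix n
      have "(h x (Suc n) * a (Suc n)) powr p * (h x (Suc n) * d n) powr (1 - p)
        = (h x (Suc n) powr p * h x (Suc n) powr (1 - p)) * (a (Suc n) powr p * a (Suc n) powr (q * (1 - p)))
          * v n powr ((1 - q) * (1 - p))"
        using h_pos[OF x, of n] apos[of n] v_pos[of n] by (simp add: d_def powr_mult powr_powr)
      also have "\<dots> = v n * h x (Suc n)"
        unfolding exponents using h_pos[OF x, of n] apos[of n] v_pos[of n] p by (simp flip: powr_add)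
      finally show "ennreal (v n * h x (Suc n)) =
          epow (ennreal (h x (Suc n) * a (Suc n))) p * epow (ennreal (h x (Suc n) * d n)) (1 - p)"
        using h_pos[OF x, of n] apos[of n] d_pos[of n] by (simp add: epow_ennreal flip: ennreal_mult)
    qed
    also have "\<dots> \<le> epow (?G x) p * epow (?Q x) (1 - p)" by (intro suminf_Holder p)
    finally have "ennreal (?c powr (1 - q)) * epow (?G x) q < ?Q x"
      by (rule less_Holder_imp_epow_less[OF c])
    then have "ennreal (w x) * (ennreal (?c powr (1 - q)) * epow (?G x) q) < ennreal (w x) * ?Q x"
      using w_pos[OF x] by (intro ennreal_mult_strict_left_mono) auto
    also have "ennreal (w x) * (ennreal (?c powr (1 - q)) * epow (?G x) q)
        = ennreal (w x * ?c powr (1 - q)) * epow (?G x) q"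
      using w_pos[OF x] by (simp add: ennreal_mult mult.assoc)
    also have "w x * ?c powr (1 - q) = kk \<sigma> powr (1 - q) * lhs3_weight x"
    proof -
      have "w x * ?c powr (1 - q) = kk \<sigma> powr (1 - q) * (1 - th x) powr (1 - q) * \<mu> x
          * (U \<mu> x powr (\<delta> * \<sigma> - 1) * U \<mu> x powr (- \<delta> * \<sigma> * (1 - q)))"
        using kk_pos theta_less_1[OF x] U_pos[OF x] by (simp add: w_def powr_mult powr_powr)
      also have "U \<mu> x powr (\<delta> * \<sigma> - 1) * U \<mu> x powr (- \<delta> * \<sigma> * (1 - q)) = U \<mu> x powr (- (1 - q * \<delta> * \<sigma>))"
        by (simp add: algebra_simps flip: powr_add)
      finally show ?thesis using U_pos[OF x] by (simp only: powr_minus) (simp add: divide_simps)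
    qed
    finally show ?thesis
      using mu_pos[OF x] by (simp add: ennreal_mult mult.assoc del: times_divide_eq_right)
  qed
  have rhs: "(\<integral>\<^sup>+x. ennreal (w x) * ?Q x \<partial>R) = ennreal (kk \<sigma>) * ?S"
  proof -
    have "(\<integral>\<^sup>+x. ennreal (w x) * ?Q x \<partial>R) = (\<integral>\<^sup>+x. (\<Sum>n. ennreal (d n) * ennreal (h x (Suc n) * w x)) \<partial>R)"
    proof (intro nn_integral_cong)
      fix x assume "x \<in> space R"
      then have x: "x > 0" by simp
      have "ennreal (w x) * ?Q x = (\<Sum>n. ennreal (w x) * ennreal (h x (Suc n) * d n))" by simp
      also have "\<dots> = (\<Sum>n. ennreal (d n) * ennreal (h x (Suc n) * w x))"
        using w_pos[OF x] d_pos by (intro suminf_cong) (simp add: mult_ac less_imp_le flip: ennreal_mult')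
      finally show "ennreal (w x) * ?Q x = \<dots>" .
    qed
    also have "\<dots> = (\<Sum>n. \<integral>\<^sup>+x. ennreal (d n) * ennreal (h x (Suc n) * w x) \<partial>R)"
      by (intro nn_integral_suminf) measurable
    also have "\<dots> = (\<Sum>n. ennreal (kk \<sigma>) * ennreal (Ps (Suc n) * a (Suc n) powr q))"
    proof (intro suminf_cong)
      fix n
      have "(\<integral>\<^sup>+x. ennreal (d n) * ennreal (h x (Suc n) * w x) \<partial>R) = ennreal (d n) * ennreal (W (Suc n) powr (- \<sigma>) * kk \<sigma>)"
        by (subst nn_integral_cmult) (auto simp: nn_integral_h_w)
      then show "(\<integral>\<^sup>+x. ennreal (d n) * ennreal (h x (Suc n) * w x) \<partial>R) = ennreal (kk \<sigma>) * ennreal (Ps (Suc n) * a (Suc n) powr q)"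
        using d_pos[of n] kk_pos by (simp add: Psi_eq d_def v_def mult_ac flip: ennreal_mult')
    qed
    also have "\<dots> = ennreal (kk \<sigma>) * ?S" by simp
    finally show ?thesis .
  qed
  have fin: "ennreal (kk \<sigma>) * ?S < \<infinity>"
    using a by (simp add: adm_seq_def ennreal_mult_less_top)
  have "ennreal (kk \<sigma> powr (1 - q)) * lhs3_int a
      = (\<integral>\<^sup>+x. ennreal (kk \<sigma> powr (1 - q)) * (ennreal (lhs3_weight x) * epow (?G x) q) \<partial>R)"
    by (intro nn_integral_cmult[symmetric]) measurable
  also have "\<dots> < (\<integral>\<^sup>+x. ennreal (w x) * ?Q x \<partial>R)"
  proof (rule nn_integral_less_greaterThan)
    have "(\<integral>\<^sup>+x. ennreal (kk \<sigma> powr (1 - q)) * (ennreal (lhs3_weight x) * epow (?G x) q) \<partial>R)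
        \<le> (\<integral>\<^sup>+x. ennreal (w x) * ?Q x \<partial>R)"
      using pointwise by (intro nn_integral_mono) (auto intro: less_imp_le)
    then show "(\<integral>\<^sup>+x. ennreal (kk \<sigma> powr (1 - q)) * (ennreal (lhs3_weight x) * epow (?G x) q) \<partial>R) \<noteq> \<infinity>"
      using fin unfolding rhs by (auto simp: top_unique)
    show "(\<lambda>x. ennreal (kk \<sigma> powr (1 - q)) * (ennreal (lhs3_weight x) * epow (?G x) q)) \<in> borel_measurable R"
      by measurable
    show "(\<lambda>x. ennreal (w x) * ?Q x) \<in> borel_measurable R"
      by measurable
  qed (rule pointwise)
  finally have "ennreal (kk \<sigma> powr (1 - q)) * lhs3_int a < ennreal (kk \<sigma>) * ?S"
    unfolding rhs .
  then have "ennreal (kk \<sigma> powr (q - 1)) * (ennreal (kk \<sigma> powr (1 - q)) * lhs3_int a) < ennreal (kk \<sigma> powr (q - 1)) * (ennreal (kk \<sigma>) * ?S)"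
    using kk_pos by (intro ennreal_mult_strict_left_mono) auto
  moreover have "kk \<sigma> powr (q - 1) * kk \<sigma> = kk \<sigma> powr q" "kk \<sigma> powr (q - 1) * kk \<sigma> powr (1 - q) = 1"
    using kk_pos by (simp_all add: powr_diff flip: powr_add)
  ultimately have "lhs3_int a < ennreal (kk \<sigma> powr q) * ?S"
    using kk_pos by (simp add: mult.assoc[symmetric] flip: ennreal_mult')
  then have "epow (ennreal (kk \<sigma> powr q) * ?S) (1 / q) < epow (lhs3_int a) (1 / q)"
    using q_neg by (intro epow_strict_antimono) auto
  then show ?thesis
    using kk_pos q_neg apos by (simp add: epow_mult_real powr_powr lhs3_def seq_norm_eq)
qed

text \<open>The reverse Hoelder inequality for $\int f \cdot \sum_n H a_n$. If the left-hand side
  of the first inequality is finite, the series diverges at almost no point with $f(x) > 0$, so the pointwise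
  identity behind the estimate holds almost everywhere.\<close>

lemma lhs1_ge_lhs3:
  assumes fm [measurable]: "f \<in> borel_measurable R" and f0: "\<And>x. x > 0 \<Longrightarrow> f x \<ge> 0" and a: "\<And>n. a (Suc n) > 0"
  shows "fun_norm p Pt f * lhs3 h th \<mu> \<delta> \<sigma> q a \<le> lhs1 h f a"
proof (cases "lhs1 h f a = top")
  case False
  let ?G = "\<lambda>x. \<Sum>n. ennreal (h x (Suc n) * a (Suc n))"
  let ?I = "\<integral>\<^sup>+x. ennreal (Pt x * f x powr p) \<partial>R"
  have lhs1: "lhs1 h f a = (\<integral>\<^sup>+x. ennreal (f x) * ?G x \<partial>R)"
  proof -
    have "lhs1 h f a = (\<integral>\<^sup>+x. (\<Sum>n. ennreal (h x (Suc n) * a (Suc n) * f x)) \<partial>R)"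
      unfolding lhs1_def by (intro nn_integral_suminf[symmetric]) measurable
    also have "\<dots> = (\<integral>\<^sup>+x. ennreal (f x) * ?G x \<partial>R)"
    proof (intro nn_integral_cong)
      fix x assume "x \<in> space R"
      then have x: "x > 0" by simp
      have "(\<Sum>n. ennreal (h x (Suc n) * a (Suc n) * f x)) = (\<Sum>n. ennreal (f x) * ennreal (h x (Suc n) * a (Suc n)))"
        using f0[OF x] by (intro suminf_cong) (simp add: mult_ac flip: ennreal_mult')
      then show "(\<Sum>n. ennreal (h x (Suc n) * a (Suc n) * f x)) = ennreal (f x) * ?G x" by simp
    qed
    finally show ?thesis .
  qed
  \<comment> \<open>where $f > 0$ and the series is infinite, the pointwise bound below would fail, since $\<infinity> \<cdot> 0 = 0$\<close>
  have "AE x in R. ennreal (f x) * ?G x \<noteq> \<infinity>"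
    using False unfolding lhs1 by (intro nn_integral_PInf_AE) auto
  moreover have "AE x in R. x > 0" by (intro AE_I2) simp
  ultimately have "AE x in R. ennreal (Pt x * f x powr p)
      \<le> epow (ennreal (f x) * ?G x) p * epow (ennreal (lhs3_weight x) * epow (?G x) q) (1 - p)"
  proof eventually_elim
    case (elim x)
    then have x: "x > 0" by simp
    show ?case
    proof (cases "f x = 0")
      case True
      then show ?thesis using p by simp
    next
      case False
      then have fx: "f x > 0" using f0[OF x] by simp
      have "?G x \<noteq> top" using elim fx by (auto simp: ennreal_mult_eq_top_iff)
      moreover have "?G x \<noteq> 0"
        using ennreal_le_suminf[of "\<lambda>n. ennreal (h x (Suc n) * a (Suc n))" 0] h_pos[OF x, of 0] a[of 0]
        by (auto simp: ennreal_eq_0_iff mult_le_0_iff)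
      ultimately obtain g where g: "g > 0" "?G x = ennreal g"
        by (cases "?G x" rule: epow_finite_pos_cases) auto
      have lw: "lhs3_weight x > 0" using theta_less_1[OF x] mu_pos[OF x] U_pos[OF x] by simp
      have "lhs3_weight x = (1 - th x) powr (1 - q) * \<mu> x * U \<mu> x powr (- (1 - q * \<delta> * \<sigma>))"
        by (simp only: powr_minus divide_inverse)
      then have "lhs3_weight x powr (1 - p) = (1 - th x) powr ((1 - q) * (1 - p)) * \<mu> x powr (1 - p)
          * U \<mu> x powr ((q * \<delta> * \<sigma> - 1) * (1 - p))"
        using theta_less_1[OF x] mu_pos[OF x] U_pos[OF x]
        by (simp only:) (simp add: powr_mult powr_powr)
      also have "\<dots> = (1 - th x) * \<mu> x powr (1 - p) * U \<mu> x powr ((q * \<delta> * \<sigma> - 1) * (1 - p))"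
        unfolding exponents using theta_less_1[OF x] p by simp
      also have "(q * \<delta> * \<sigma> - 1) * (1 - p) = \<delta> * \<sigma> * (q * (1 - p)) - (1 - p)"
        by (simp add: algebra_simps)
      also have "\<delta> * \<sigma> * (q * (1 - p)) - (1 - p) = p * (1 - \<delta> * \<sigma>) - 1"
        unfolding exponents by (simp add: algebra_simps)
      also have "(1 - th x) * \<mu> x powr (1 - p) * U \<mu> x powr (p * (1 - \<delta> * \<sigma>) - 1) = Pt x"
        using mu_pos[OF x] by (simp add: \<Phi>t_def \<Phi>_def powr_diff divide_simps)
      finally have lw': "lhs3_weight x powr (1 - p) = Pt x" .
      have "(f x * g) powr p * (l * g powr q) powr (1 - p)
          = l powr (1 - p) * f x powr p * (g powr p * g powr (q * (1 - p)))" if "l > 0" for l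
        using that fx g by (simp add: powr_mult powr_powr)
      from this[OF lw] have "(f x * g) powr p * (lhs3_weight x * g powr q) powr (1 - p)
          = lhs3_weight x powr (1 - p) * f x powr p * (g powr p * g powr (q * (1 - p)))" .
      also have "\<dots> = Pt x * f x powr p"
        unfolding lw' exponents(1) using g by (simp flip: powr_add)
      finally have eq: "(f x * g) powr p * (lhs3_weight x * g powr q) powr (1 - p) = Pt x * f x powr p" .
      have "epow (ennreal (f x) * ?G x) p = ennreal ((f x * g) powr p)"
        using fx g by (simp add: epow_ennreal flip: ennreal_mult)
      moreover have "epow (ennreal l * epow (?G x) q) (1 - p) = ennreal ((l * g powr q) powr (1 - p))" if "l > 0" for l
        using that g by (simp add: epow_ennreal flip: ennreal_mult)
      from this[OF lw] have "epow (ennreal (lhs3_weight x) * epow (?G x) q) (1 - p)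
          = ennreal ((lhs3_weight x * g powr q) powr (1 - p))" .
      ultimately show ?thesis by (simp only: eq ennreal_mult[symmetric] powr_ge_zero order_refl)
    qed
  qed
  then have "?I \<le> (\<integral>\<^sup>+x. epow (ennreal (f x) * ?G x) p * epow (ennreal (lhs3_weight x) * epow (?G x) q) (1 - p) \<partial>R)"
    by (rule nn_integral_mono_AE)
  also have "\<dots> \<le> epow (lhs1 h f a) p * epow (lhs3_int a) (1 - p)"
    unfolding lhs1 by (intro nn_integral_Holder p) measurable
  finally have I: "?I \<le> epow (lhs1 h f a) p * epow (lhs3_int a) (1 - p)" .
  then have "epow ?I (1 / p) \<le> epow (epow (lhs1 h f a) p * epow (lhs3_int a) (1 - p)) (1 / p)"
    using p by (intro epow_mono) auto
  also have "\<dots> = lhs1 h f a * epow (lhs3_int a) (- 1 / q)"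
    using p by (simp add: epow_mult epow_epow exponents)
  finally have le: "fun_norm p Pt f \<le> lhs1 h f a * epow (lhs3_int a) (- 1 / q)"
    using f0 by (simp add: fun_norm_eq Pt_pos less_imp_le)
  show ?thesis
  proof (cases "lhs3_int a" rule: epow_finite_pos_cases)
    case zero
    then have "?I = 0" using I p by simp
    then show ?thesis using f0 p by (simp add: fun_norm_eq Pt_pos less_imp_le)
  next
    case top
    then show ?thesis using q_neg by (simp add: lhs3_def)
  next
    case (real t)
    have "fun_norm p Pt f * lhs3 h th \<mu> \<delta> \<sigma> q a \<le> lhs1 h f a * epow (lhs3_int a) (- 1 / q) * lhs3 h th \<mu> \<delta> \<sigma> q a"
      by (intro mult_right_mono le) auto
    also have "\<dots> = lhs1 h f a * (epow (lhs3_int a) (- 1 / q) * epow (lhs3_int a) (1 / q))"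
      by (simp add: lhs3_def mult.assoc)
    also have "epow (lhs3_int a) (- 1 / q) * epow (lhs3_int a) (1 / q) = 1"
      using real by (simp add: epow_ennreal flip: ennreal_mult powr_add)
    finally show ?thesis by simp
  qed
qed simp

lemma bound3_imp_bound1:
  assumes f: "adm_fun f" and a: "adm_seq a" and K: "ennreal K * seq_norm q Ps a < lhs3 h th \<mu> \<delta> \<sigma> q a"
  shows "ennreal K * fun_norm p Pt f * seq_norm q Ps a < lhs1 h f a"
proof -
  have "fun_norm p Pt f * (ennreal K * seq_norm q Ps a) < fun_norm p Pt f * lhs3 h th \<mu> \<delta> \<sigma> q a"
    using fun_norm_Pt_pos_finite[OF f] K by (intro ennreal_mult_strict_left_mono) auto
  also have "\<dots> \<le> lhs1 h f a"
    using f a by (intro lhs1_ge_lhs3) (auto simp: adm_fun_def adm_seq_def)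
  finally show ?thesis by (simp add: mult_ac)
qed

section \<open>Optimality of the constant\<close>

text \<open>The substitution $t = U^\<delta>$ turns this into $\int_0^1 t^{b-1}\,dt$. The cut at
  $U^\<delta> \<le> 1$ selects a neighbourhood of $0$ or of $\<infinity>$ according to the sign of
  $\<delta>$.\<close>

lemma nn_integral_U_cut:
  assumes b: "b > 0"
  shows "(\<integral>\<^sup>+x. ennreal (if U \<mu> x powr \<delta> \<le> 1 then U \<mu> x powr (\<delta> * b - 1) * \<mu> x else 0) \<partial>R) = ennreal (1 / b)"
proof -
  let ?F = "\<lambda>t::real. if t \<in> {0<..1} then t powr (b - 1) else 0"
  have F: "(?F has_integral (1 / b)) {0<..}"
    using has_integral_powr_Ioc[of "b - 1" 1] b by (subst has_integral_restrict) auto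
  then have "?F absolutely_integrable_on {0<..}"
    by (intro nonnegative_absolutely_integrable_1) (auto simp: integrable_on_def)
  then have "(\<integral>\<^sup>+x. ennreal (1 * U \<mu> x powr (\<delta> - 1) * \<mu> x * ?F (U \<mu> x powr \<delta> * 1)) \<partial>R) = ennreal (integral {0<..} ?F)"
    by (intro nn_integral_substitution_U) auto
  also have "integral {0<..} ?F = 1 / b" using F by (rule integral_unique)
  also have "(\<integral>\<^sup>+x. ennreal (1 * U \<mu> x powr (\<delta> - 1) * \<mu> x * ?F (U \<mu> x powr \<delta> * 1)) \<partial>R)
    = (\<integral>\<^sup>+x. ennreal (if U \<mu> x powr \<delta> \<le> 1 then U \<mu> x powr (\<delta> * b - 1) * \<mu> x else 0) \<partial>R)"
  proof (intro nn_integral_cong arg_cong[where f = ennreal])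
    fix x assume "x \<in> space R"
    then have u: "U \<mu> x > 0" using U_pos by simp
    have "U \<mu> x powr (\<delta> - 1) * (U \<mu> x powr \<delta>) powr (b - 1) = U \<mu> x powr (\<delta> * b - 1)"
      by (simp add: powr_powr algebra_simps flip: powr_add)
    then show "1 * U \<mu> x powr (\<delta> - 1) * \<mu> x * ?F (U \<mu> x powr \<delta> * 1)
      = (if U \<mu> x powr \<delta> \<le> 1 then U \<mu> x powr (\<delta> * b - 1) * \<mu> x else 0)"
      using u by (simp add: mult_ac)
  qed
  finally show ?thesis .
qed

text \<open>The bound of \<open>kern_initial_le\<close> at $a = U^\<delta> V_{n_0}$, divided by
  $k(\<sigma>)\, U^{\<delta>(\<sigma>-\<gamma>)}$.\<close>

definition theta_const :: real where
  "theta_const = 2 * V \<nu> n0 powr (\<sigma> - \<gamma>) / (\<rho> * (\<sigma> - \<gamma>) * kk \<sigma>)"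

lemma theta_const_nonneg: "theta_const \<ge> 0"
  using rho gamma_less kk_pos by (simp add: theta_const_def)

lemma theta_le:
  assumes "x > 0"
  shows "th x \<le> theta_const * U \<mu> x powr (\<delta> * (\<sigma> - \<gamma>))"
proof -
  have pos: "U \<mu> x powr \<delta> > 0" "V \<nu> n0 > 0" using U_pos[OF assms] V_pos[OF n0] by auto
  have "th x \<le> 1 / kk \<sigma> * (2 / (\<rho> * (\<sigma> - \<gamma>)) * (U \<mu> x powr \<delta> * V \<nu> n0) powr (\<sigma> - \<gamma>))"
    unfolding \<theta>_def using pos kk_pos
    by (intro mult_left_mono kern_initial_le[OF alpha rho gamma gamma_less]) auto
  also have "\<dots> = theta_const * U \<mu> x powr (\<delta> * (\<sigma> - \<gamma>))"
    using pos by (simp add: theta_const_def powr_mult powr_powr mult_ac)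
  finally show ?thesis .
qed

text \<open>The extremal candidates of the inequality are $f = U^{\<delta>\<sigma>-1}\<mu>$ and
  $a_n = \widetilde V_n^{\<sigma>-1}\<nu>_n$, for which the integral and the series in the two norms
  diverge. The parameter $e > 0$ makes them finite, of order $1/e$. The shifts $e/p$ and $-e/q$ are
  chosen so that their difference is $e\,(1/p + 1/q) = e$.\<close>

definition test_fun :: "real \<Rightarrow> real \<Rightarrow> real" where
  "test_fun e x = (if U \<mu> x powr \<delta> \<le> 1 then U \<mu> x powr (\<delta> * (\<sigma> + e / p) - 1) * \<mu> x else 0)"

definition test_seq :: "real \<Rightarrow> nat \<Rightarrow> real" where
  "test_seq e n = W n powr (\<sigma> - e / q - 1) * \<nu> n"

lemma test_fun_nonneg: "x > 0 \<Longrightarrow> test_fun e x \<ge> 0"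
  using mu_pos[of x] by (simp add: test_fun_def)

lemma test_fun_measurable [measurable]: "test_fun e \<in> borel_measurable R"
  unfolding test_fun_def[abs_def] by measurable

lemma Phi_test_fun:
  assumes x: "x > 0"
  shows "Ph x * test_fun e x powr p = (if U \<mu> x powr \<delta> \<le> 1 then U \<mu> x powr (\<delta> * e - 1) * \<mu> x else 0)"
proof -
  have u: "U \<mu> x > 0" "\<mu> x > 0" using U_pos mu_pos x by auto
  have "Ph x * (U \<mu> x powr (\<delta> * (\<sigma> + e / p) - 1) * \<mu> x) powr p
    = (U \<mu> x powr (p * (1 - \<delta> * \<sigma>) - 1) * U \<mu> x powr ((\<delta> * (\<sigma> + e / p) - 1) * p)) * (\<mu> x powr (1 - p) * \<mu> x powr p)"
  proof -
    have "Ph x = U \<mu> x powr (p * (1 - \<delta> * \<sigma>) - 1) * \<mu> x powr (1 - p)"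
      using u by (simp add: \<Phi>_def powr_diff divide_simps)
    then show ?thesis using u by (simp add: powr_mult powr_powr)
  qed
  also have "(\<mu> x powr (1 - p) * \<mu> x powr p) = \<mu> x"
    using u by (simp flip: powr_add)
  also have "U \<mu> x powr (p * (1 - \<delta> * \<sigma>) - 1) * U \<mu> x powr ((\<delta> * (\<sigma> + e / p) - 1) * p) = U \<mu> x powr (\<delta> * e - 1)"
  proof -
    have "p * (1 - \<delta> * \<sigma>) - 1 + (\<delta> * (\<sigma> + e / p) - 1) * p = \<delta> * e - 1"
      using p by (simp add: field_simps)
    then show ?thesis by (simp only: powr_add[symmetric])
  qed
  finally show ?thesis using p by (simp add: test_fun_def)
qed

lemma Phi_integral_test_fun:
  assumes "e > 0"
  shows "(\<integral>\<^sup>+x. ennreal (Ph x * test_fun e x powr p) \<partial>R) = ennreal (1 / e)"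
proof -
  have "(\<integral>\<^sup>+x. ennreal (Ph x * test_fun e x powr p) \<partial>R) =
    (\<integral>\<^sup>+x. ennreal (if U \<mu> x powr \<delta> \<le> 1 then U \<mu> x powr (\<delta> * e - 1) * \<mu> x else 0) \<partial>R)"
    by (intro nn_integral_cong arg_cong[where f = ennreal] Phi_test_fun) simp
  then show ?thesis using nn_integral_U_cut[OF assms] by simp
qed

lemma adm_fun_test_fun: "e > 0 \<Longrightarrow> adm_fun (test_fun e)"
  by (simp add: adm_fun_def test_fun_nonneg Phi_integral_test_fun)

text \<open>The defect costs only a bounded amount as $e \<rightarrow> 0$, because $\<theta>$ adds the
  positive power $\<sigma> - \<gamma>$ to an integrand that is barely integrable.\<close>

lemma Pt_integral_test_fun_ge:
  assumes e: "e > 0"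
  shows "ennreal (1 / e) \<le> (\<integral>\<^sup>+x. ennreal (Pt x * test_fun e x powr p) \<partial>R) + ennreal (theta_const / (\<sigma> - \<gamma>))"
proof -
  let ?c = "\<lambda>x. if U \<mu> x powr \<delta> \<le> 1 then U \<mu> x powr (\<delta> * (\<sigma> - \<gamma> + e) - 1) * \<mu> x else 0"
  have "ennreal (1 / e) = (\<integral>\<^sup>+x. ennreal (Ph x * test_fun e x powr p) \<partial>R)"
    using Phi_integral_test_fun[OF e] by simp
  also have "\<dots> \<le> (\<integral>\<^sup>+x. ennreal (Pt x * test_fun e x powr p) + ennreal theta_const * ennreal (?c x) \<partial>R)"
  proof (intro nn_integral_mono)
    fix x assume "x \<in> space R"
    then have x: "x > 0" by simp
    have c0: "?c x \<ge> 0" using mu_pos[OF x] by simp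
    have "th x * (Ph x * test_fun e x powr p)
        \<le> theta_const * U \<mu> x powr (\<delta> * (\<sigma> - \<gamma>)) * (Ph x * test_fun e x powr p)"
      using theta_le[OF x] Phi_pos[OF x] by (intro mult_right_mono) auto
    also have "\<dots> = theta_const * ?c x"
      by (simp add: Phi_test_fun[OF x] algebra_simps flip: powr_add)
    finally have "Ph x * test_fun e x powr p \<le> Pt x * test_fun e x powr p + theta_const * ?c x"
      by (simp add: \<Phi>t_def algebra_simps)
    then have "ennreal (Ph x * test_fun e x powr p) \<le> ennreal (Pt x * test_fun e x powr p + theta_const * ?c x)"
      by (rule ennreal_leI)
    also have "\<dots> = ennreal (Pt x * test_fun e x powr p) + ennreal theta_const * ennreal (?c x)"
      using theta_const_nonneg c0 Pt_pos[OF x] by (subst ennreal_plus) (auto simp: ennreal_mult')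
    finally show "ennreal (Ph x * test_fun e x powr p) \<le> \<dots>" .
  qed
  also have "\<dots> = (\<integral>\<^sup>+x. ennreal (Pt x * test_fun e x powr p) \<partial>R) + ennreal theta_const * (\<integral>\<^sup>+x. ennreal (?c x) \<partial>R)"
    by (simp add: nn_integral_add nn_integral_cmult)
  also have "ennreal theta_const * (\<integral>\<^sup>+x. ennreal (?c x) \<partial>R) = ennreal (theta_const / (\<sigma> - \<gamma> + e))"
    using nn_integral_U_cut[of "\<sigma> - \<gamma> + e"] gamma_less e theta_const_nonneg by (simp flip: ennreal_mult')
  also have "(\<integral>\<^sup>+x. ennreal (Pt x * test_fun e x powr p) \<partial>R) + ennreal (theta_const / (\<sigma> - \<gamma> + e))
    \<le> (\<integral>\<^sup>+x. ennreal (Pt x * test_fun e x powr p) \<partial>R) + ennreal (theta_const / (\<sigma> - \<gamma>))"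
    using gamma_less e theta_const_nonneg by (intro add_left_mono ennreal_leI divide_left_mono) auto
  finally show ?thesis .
qed

abbreviation "test_sum e \<equiv> (\<Sum>n. ennreal (\<nu> (Suc n) * W (Suc n) powr (- 1 - e)))"

text \<open>A bound, uniform in $0 < e \<le> 1$, for the finitely many terms that precede the
  range of the integral test.\<close>

definition head_const :: real where
  "head_const = (\<Sum>i<Suc n0. \<nu> (Suc i) * (W (Suc i) powr (- 1) + W (Suc i) powr (- 2)))"

text \<open>After the index $n_0 + 1$ each term is at most
  $\<nu>_{n-1} V_{n-1}^{-1-e}$, since $\widetilde V_n \<ge> V_{n-1}$ and the $\<nu>_n$ decrease;
  each of these is at most the difference $(V_{n-2}^{-e} - V_{n-1}^{-e})/e$.\<close>

lemma test_sum_le: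
  assumes e: "0 < e" "e \<le> 1"
  shows "test_sum e \<le> ennreal (head_const + V \<nu> n0 powr (- e) / e)"
proof (rule suminf_le_const[OF summableI])
  fix N
  let ?t = "\<lambda>i. \<nu> (Suc i) * W (Suc i) powr (- 1 - e)"
  have t0: "?t i \<ge> 0" for i using nu_pos[of "Suc i"] by simp
  have head: "(\<Sum>i<Suc n0. ?t i) \<le> head_const"
    unfolding head_const_def
  proof (intro sum_mono mult_left_mono)
    fix i
    have w0: "W (Suc i) > 0" by (rule W_pos) simp
    show "W (Suc i) powr (- 1 - e) \<le> W (Suc i) powr (- 1) + W (Suc i) powr (- 2)"
    proof (cases "W (Suc i) \<le> 1")
      case True
      then have "W (Suc i) powr (- 1 - e) \<le> W (Suc i) powr (- 2)"
        using w0 e by (intro powr_mono') auto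
      then show ?thesis by (smt (verit) powr_ge_zero)
    next
      case False
      then have "W (Suc i) powr (- 1 - e) \<le> W (Suc i) powr (- 1)"
        using e by (intro powr_mono) auto
      then show ?thesis by (smt (verit) powr_ge_zero)
    qed
    show "0 \<le> \<nu> (Suc i)" using nu_pos[of "Suc i"] by simp
  qed
  have tail: "(\<Sum>j<N. ?t (Suc n0 + j)) \<le> (V \<nu> n0 powr (- e) - V \<nu> (n0 + N) powr (- e)) / e"
  proof (induction N)
    case (Suc N)
    have pos: "0 < V \<nu> (n0 + N)" using n0 by (intro V_pos) auto
    have "?t (Suc n0 + N) \<le> \<nu> (Suc (n0 + N)) * V \<nu> (Suc (n0 + N)) powr (- 1 - e)"
      using nu_decr[of "Suc (n0 + N)"] nu_pos[of "Suc (Suc (n0 + N))"] W_ge[of "Suc (n0 + N)"]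
        V_pos[of "Suc (n0 + N)"] e
      by (intro mult_mono powr_mono2') auto
    also have "\<dots> = (V \<nu> (Suc (n0 + N)) - V \<nu> (n0 + N)) * V \<nu> (Suc (n0 + N)) powr (- 1 - e)"
      by (simp add: V_Suc)
    also have "\<dots> \<le> (V \<nu> (n0 + N) powr (- e) - V \<nu> (Suc (n0 + N)) powr (- e)) / e"
      using pos e by (intro powr_difference_ge V_strict_mono) auto
    finally show ?case using Suc.IH by (simp add: diff_divide_distrib)
  qed simp
  have "(\<Sum>i<N. ?t i) \<le> (\<Sum>i<Suc n0 + N. ?t i)"
    using t0 by (intro sum_mono2) auto
  also have "\<dots> = (\<Sum>i<Suc n0. ?t i) + (\<Sum>j<N. ?t (Suc n0 + j))"
    by (induction N) (simp_all add: add.assoc)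
  also have "\<dots> \<le> head_const + V \<nu> n0 powr (- e) / e"
  proof -
    have "(V \<nu> n0 powr (- e) - V \<nu> (n0 + N) powr (- e)) / e \<le> V \<nu> n0 powr (- e) / e"
      using e by (intro divide_right_mono) auto
    then show ?thesis using head tail by linarith
  qed
  finally have "(\<Sum>i<N. ?t i) \<le> head_const + V \<nu> n0 powr (- e) / e" .
  then show "(\<Sum>i<N. ennreal (?t i)) \<le> ennreal (head_const + V \<nu> n0 powr (- e) / e)"
    using t0 by (subst sum_ennreal) (auto intro: ennreal_leI)
qed

lemma test_seq_pos: "test_seq e (Suc n) > 0"
  using W_pos[of "Suc n"] nu_pos[of "Suc n"] by (simp add: test_seq_def)

lemma Psi_test_seq: "Ps (Suc n) * test_seq e (Suc n) powr q = \<nu> (Suc n) * W (Suc n) powr (- 1 - e)"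
proof -
  have pos: "W (Suc n) > 0" "\<nu> (Suc n) > 0" using W_pos nu_pos by auto
  have "Ps (Suc n) * test_seq e (Suc n) powr q
    = (W (Suc n) powr (q * (1 - \<sigma>) - 1) * W (Suc n) powr ((\<sigma> - e / q - 1) * q)) * (\<nu> (Suc n) powr (1 - q) * \<nu> (Suc n) powr q)"
  proof -
    have "Ps (Suc n) = W (Suc n) powr (q * (1 - \<sigma>) - 1) * \<nu> (Suc n) powr (1 - q)"
      using pos by (simp add: \<Psi>t_def powr_diff divide_simps)
    then show ?thesis using pos by (simp add: test_seq_def powr_mult powr_powr)
  qed
  also have "\<nu> (Suc n) powr (1 - q) * \<nu> (Suc n) powr q = \<nu> (Suc n)"
    using pos by (simp flip: powr_add)
  also have "W (Suc n) powr (q * (1 - \<sigma>) - 1) * W (Suc n) powr ((\<sigma> - e / q - 1) * q) = W (Suc n) powr (- 1 - e)"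
  proof -
    have "q * (1 - \<sigma>) - 1 + (\<sigma> - e / q - 1) * q = - 1 - e"
      using q_neg by (simp add: field_simps)
    then show ?thesis by (simp only: powr_add[symmetric])
  qed
  finally show ?thesis by simp
qed

lemma test_sum_pos_finite:
  assumes "0 < e" "e \<le> 1"
  shows "0 < test_sum e" "test_sum e < \<infinity>"
proof -
  show "0 < test_sum e"
    using nu_pos[of 1] W_pos[of 1]
    by (intro less_le_trans[OF _ ennreal_le_suminf[where n = 0]]) auto
  show "test_sum e < \<infinity>" using test_sum_le[OF assms] by (auto intro: le_less_trans)
qed

lemma adm_seq_test_seq: "0 < e \<Longrightarrow> e \<le> 1 \<Longrightarrow> adm_seq (test_seq e)"
  using test_sum_pos_finite by (simp add: adm_seq_def test_seq_pos Psi_test_seq)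

text \<open>Dropping the cut $U^\<delta> \<le> 1$ makes the integral exact again, with
  $\<sigma> + e/p$ in place of $\<sigma>$; the powers of $\widetilde V_n$ then combine to
  $\widetilde V_n^{-1-e}$.\<close>

lemma lhs1_test_le:
  assumes e: "0 < e"
  shows "lhs1 h (test_fun e) (test_seq e) \<le> ennreal (kk (\<sigma> + e / p)) * test_sum e"
proof -
  let ?s = "\<sigma> + e / p"
  have s: "\<gamma> < ?s" using gamma_less divide_pos_pos[of e p] e p by linarith
  have ks: "kk ?s > 0" by (rule k_pos[OF alpha rho gamma s])
  have "lhs1 h (test_fun e) (test_seq e) \<le> (\<Sum>n. ennreal (kk ?s) * ennreal (\<nu> (Suc n) * W (Suc n) powr (- 1 - e)))"
    unfolding lhs1_def
  proof (intro suminf_le summableI)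
    fix n
    have pos: "W (Suc n) > 0" "\<nu> (Suc n) > 0" using W_pos nu_pos by auto
    have "(\<integral>\<^sup>+x. ennreal (h x (Suc n) * test_seq e (Suc n) * test_fun e x) \<partial>R)
      \<le> (\<integral>\<^sup>+x. ennreal (test_seq e (Suc n)) * ennreal (ker (U \<mu> x powr \<delta> * W (Suc n)) * U \<mu> x powr (\<delta> * ?s - 1) * \<mu> x) \<partial>R)"
    proof (intro nn_integral_mono)
      fix x assume "x \<in> space R"
      then have x: "x > 0" by simp
      have "test_fun e x \<le> U \<mu> x powr (\<delta> * ?s - 1) * \<mu> x"
        using mu_pos[OF x] by (simp add: test_fun_def)
      then have "h x (Suc n) * test_seq e (Suc n) * test_fun e x
          \<le> h x (Suc n) * test_seq e (Suc n) * (U \<mu> x powr (\<delta> * ?s - 1) * \<mu> x)"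
        using h_pos[OF x, of n] test_seq_pos[of e n] by (intro mult_left_mono) auto
      also have "\<dots> = test_seq e (Suc n) * (ker (U \<mu> x powr \<delta> * W (Suc n)) * U \<mu> x powr (\<delta> * ?s - 1) * \<mu> x)"
        by (simp add: H_def mult_ac)
      finally show "ennreal (h x (Suc n) * test_seq e (Suc n) * test_fun e x) \<le> ennreal (test_seq e (Suc n)) * ennreal (ker (U \<mu> x powr \<delta> * W (Suc n)) * U \<mu> x powr (\<delta> * ?s - 1) * \<mu> x)"
        using test_seq_pos[of e n] by (simp add: ennreal_leI flip: ennreal_mult')
    qed
    also have "\<dots> = ennreal (test_seq e (Suc n)) * ennreal (W (Suc n) powr (- ?s) * kk ?s)"
    proof (subst nn_integral_cmult)
      show "(\<lambda>x. ennreal (ker (U \<mu> x powr \<delta> * W (Suc n)) * U \<mu> x powr (\<delta> * ?s - 1) * \<mu> x)) \<in> borel_measurable R"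
        using h_measurable[of n] unfolding H_def by measurable
    qed (simp add: nn_integral_kern_U[OF s pos(1)])
    also have "\<dots> = ennreal (kk ?s * (\<nu> (Suc n) * (W (Suc n) powr (\<sigma> - e / q - 1) * W (Suc n) powr (- ?s))))"
      using pos ks by (simp add: test_seq_def mult_ac flip: ennreal_mult')
    also have "W (Suc n) powr (\<sigma> - e / q - 1) * W (Suc n) powr (- ?s) = W (Suc n) powr (- 1 - e * (1 / p + 1 / q))"
    proof -
      have "\<sigma> - e / q - 1 + - ?s = - 1 - e * (1 / p + 1 / q)" by (simp add: algebra_simps)
      then show ?thesis by (simp only: powr_add[symmetric])
    qed
    also have "- 1 - e * (1 / p + 1 / q) = - 1 - e" unfolding pq by simp
    finally show "(\<integral>\<^sup>+x. ennreal (h x (Suc n) * test_seq e (Suc n) * test_fun e x) \<partial>R)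
        \<le> ennreal (kk ?s) * ennreal (\<nu> (Suc n) * W (Suc n) powr (- 1 - e))"
      using ks by (simp flip: ennreal_mult')
  qed
  then show ?thesis by simp
qed

text \<open>With $I$ and $S$ the integral and the series of the two norms, the hypothesis says
  $K I^{1/p} S^{1/q} < k(\<sigma> + e/p)\, S$. As $1 - 1/q = 1/p$, this is
  $K^p I < k(\<sigma> + e/p)^p S$, and it remains to insert a lower
  bound for $e I$ and an upper bound for $e S$.\<close>

lemma constant_bound_step:
  assumes e: "0 < e" "e \<le> 1" and K: "K > 0"
    and bound: "ennreal K * fun_norm p Pt (test_fun e) * seq_norm q Ps (test_seq e) < lhs1 h (test_fun e) (test_seq e)"
  shows "K powr p * (1 - theta_const / (\<sigma> - \<gamma>) * e)
    \<le> kk (\<sigma> + e / p) powr p * (head_const * e + V \<nu> n0 powr (- e))"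
proof -
  let ?s = "\<sigma> + e / p"
  let ?D = "theta_const / (\<sigma> - \<gamma>)"
  have s: "\<gamma> < ?s" using gamma_less divide_pos_pos[of e p] e p by linarith
  have ks: "kk ?s > 0" by (rule k_pos[OF alpha rho gamma s])
  have D: "?D \<ge> 0" using theta_const_nonneg gamma_less by simp
  let ?I = "\<integral>\<^sup>+x. ennreal (Pt x * test_fun e x powr p) \<partial>R"
  obtain i where i: "i > 0" "?I = ennreal i"
    using Pt_integral_pos_finite[OF adm_fun_test_fun[OF e(1)]] by (cases ?I rule: epow_finite_pos_cases) auto
  obtain t where t: "t > 0" "test_sum e = ennreal t"
    using test_sum_pos_finite[OF e] by (cases "test_sum e" rule: epow_finite_pos_cases) auto
  have i_ge: "1 / e \<le> i + ?D"
    using Pt_integral_test_fun_ge[OF e(1)] i e D by (simp flip: ennreal_plus)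
  have head: "0 \<le> head_const"
    unfolding head_const_def using nu_pos by (intro sum_nonneg mult_nonneg_nonneg add_nonneg_nonneg) (auto simp: less_imp_le)
  have t_le: "t \<le> head_const + V \<nu> n0 powr (- e) / e"
    using test_sum_le[OF e] t e head by (simp add: ennreal_le_iff del: ennreal_plus)
  have "ennreal (K * i powr (1 / p) * t powr (1 / q)) = ennreal K * fun_norm p Pt (test_fun e) * seq_norm q Ps (test_seq e)"
    using i t K test_fun_nonneg
    by (simp add: fun_norm_eq seq_norm_eq test_seq_pos Pt_pos less_imp_le Psi_test_seq epow_ennreal ennreal_mult)
  also have "\<dots> < ennreal (kk ?s * t)"
    using less_le_trans[OF bound lhs1_test_le[OF e(1)]] t ks by (simp add: ennreal_mult)
  finally have "K * i powr (1 / p) * t powr (1 / q) < kk ?s * t"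
    using K by (subst (asm) ennreal_less_iff) auto
  then have "K * i powr (1 / p) * t powr (1 / q) * t powr (- 1 / q) < kk ?s * t * t powr (- 1 / q)"
    using t by (intro mult_strict_right_mono) auto
  moreover have "t powr (1 / q) * t powr (- 1 / q) = 1"
    using t by (simp flip: powr_add)
  moreover have "t * t powr (- 1 / q) = t powr (1 / p)"
  proof -
    have "t * t powr (- 1 / q) = t powr (1 + - 1 / q)" using t powr_add[of t 1 "- 1 / q"] by simp
    also have "1 + - 1 / q = 1 / p" using pq by linarith
    finally show ?thesis .
  qed
  ultimately have "K * i powr (1 / p) < kk ?s * t powr (1 / p)" by (simp add: mult.assoc)
  then have "(K * i powr (1 / p)) powr p < (kk ?s * t powr (1 / p)) powr p"
    using p K by (intro powr_less_mono2) auto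
  then have lt: "K powr p * i < kk ?s powr p * t"
    using K i t ks p by (simp add: powr_mult powr_powr)
  have "K powr p * (1 - ?D * e) = K powr p * (1 / e - ?D) * e"
    using e by (simp add: field_simps)
  also have "\<dots> \<le> K powr p * i * e"
    using i_ge e by (intro mult_right_mono mult_left_mono) auto
  also have "\<dots> \<le> kk ?s powr p * t * e"
    using lt e by (intro mult_right_mono) auto
  also have "\<dots> \<le> kk ?s powr p * (head_const + V \<nu> n0 powr (- e) / e) * e"
    using t_le e by (intro mult_right_mono mult_left_mono) auto
  also have "\<dots> = kk ?s powr p * (head_const * e + V \<nu> n0 powr (- e))"
    using e by (simp add: field_simps)
  finally show ?thesis .
qed

text \<open>Let $e \<rightarrow> 0$ in the preceding bound: if the larger constant $K$ were valid, then
  $K^p \<le> k(\<sigma>)^p$.\<close>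

lemma best_constant:
  assumes K: "K > kk \<sigma>"
  obtains f a where "adm_fun f" "adm_seq a" "lhs1 h f a \<le> ennreal K * fun_norm p Pt f * seq_norm q Ps a"
proof (rule ccontr)
  assume "\<not> thesis"
  with that have bound: "ennreal K * fun_norm p Pt f * seq_norm q Ps a < lhs1 h f a"
    if "adm_fun f" "adm_seq a" for f a using that by (force simp: not_le)
  have K0: "K > 0" using K kk_pos by simp
  \<comment> \<open>the factor $p$ makes $\<sigma> + e_j/p$ equal to $\<sigma> + 1/(j+1) \<le> \<sigma> + 1$\<close>
  define e where "e j = p * inverse (real (Suc j))" for j
  have e: "0 < e j" "e j \<le> 1" for j
  proof -
    show "0 < e j" using p by (simp add: e_def)
    have "e j \<le> 1 * 1" unfolding e_def using p by (intro mult_mono) (auto simp: inverse_le_1_iff)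
    then show "e j \<le> 1" by simp
  qed
  have step: "K powr p * (1 - theta_const / (\<sigma> - \<gamma>) * e j)
      \<le> kk (\<sigma> + e j / p) powr p * (head_const * e j + V \<nu> n0 powr (- e j))" for j
    by (intro constant_bound_step e K0 bound adm_fun_test_fun adm_seq_test_seq)
  have lim: "e \<longlonglongrightarrow> 0"
    unfolding e_def using tendsto_mult_right_zero[OF LIMSEQ_inverse_real_of_nat, of p] by simp
  have "(\<lambda>j. \<sigma> + e j / p) \<longlonglongrightarrow> \<sigma> + 0 / p" using p by (intro tendsto_intros lim) auto
  then have "(\<lambda>j. kk (\<sigma> + e j / p)) \<longlonglongrightarrow> kk \<sigma>"
    using p by (intro k_right_continuous[OF alpha rho gamma gamma_less])
      (auto simp: e_def inverse_le_1_iff)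
  then have "(\<lambda>j. kk (\<sigma> + e j / p) powr p * (head_const * e j + V \<nu> n0 powr (- e j)))
      \<longlonglongrightarrow> kk \<sigma> powr p * (head_const * 0 + V \<nu> n0 powr (- 0))"
    using kk_pos V_pos[OF n0] by (intro tendsto_intros lim) auto
  moreover have "(\<lambda>j. K powr p * (1 - theta_const / (\<sigma> - \<gamma>) * e j)) \<longlonglongrightarrow> K powr p * (1 - theta_const / (\<sigma> - \<gamma>) * 0)"
    by (intro tendsto_intros lim)
  ultimately have "K powr p * (1 - theta_const / (\<sigma> - \<gamma>) * 0) \<le> kk \<sigma> powr p * (head_const * 0 + V \<nu> n0 powr (- 0))"
    using step by (intro LIMSEQ_le) auto
  then have "K powr p \<le> kk \<sigma> powr p" using V_pos[OF n0] by simp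
  moreover have "kk \<sigma> powr p < K powr p" using K kk_pos p by (intro powr_less_mono2) auto
  ultimately show False by simp
qed

end

section \<open>The reverse half-discrete Hardy-Hilbert inequality\<close>

theorem theorem4:
  fixes \<alpha> \<rho> \<gamma> \<sigma> \<delta> p q :: real
    and \<mu> :: "real \<Rightarrow> real" and \<nu> \<nu>t :: "nat \<Rightarrow> real" and n0 :: nat
  assumes "\<forall>n\<ge>1. \<nu> n > 0"
    and "\<forall>n\<ge>1. 0 \<le> \<nu>t n \<and> \<nu>t n \<le> \<nu> n / 2"
    and "continuous_on {0<..} \<mu>" and "\<forall>x>0. \<mu> x > 0"
    and "\<forall>x>0. set_integrable lborel {0<..x} \<mu>"
    and "0 \<le> \<alpha>" and "\<alpha> \<le> \<rho>" and "0 < \<rho>"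
    and "0 < \<gamma>" and "\<gamma> < \<sigma>" and "\<sigma> \<le> 1"
    and "\<delta> \<in> {-1, 1}"
    and "0 < p" and "p < 1" and "1 / p + 1 / q = 1"
    and "n0 \<ge> 1" and "\<forall>n\<ge>n0. \<nu> n \<ge> \<nu> (n + 1)"
    and "U_infinity \<mu> = \<infinity>" and "V_infinity \<nu> = \<infinity>"
  shows "(\<forall>f a. admissible \<delta> \<mu> \<nu> \<nu>t \<sigma> p q f a \<longrightarrow>
       lhs1 (H \<alpha> \<rho> \<gamma> \<delta> \<mu> \<nu> \<nu>t) f a >
         ennreal (k \<alpha> \<rho> \<gamma> \<sigma>) * fun_norm p (\<Phi>t \<alpha> \<rho> \<gamma> \<delta> \<mu> \<nu> n0 \<sigma> p) f * seq_norm q (\<Psi>t \<nu> \<nu>t \<sigma> q) a \<and>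
       lhs2 (H \<alpha> \<rho> \<gamma> \<delta> \<mu> \<nu> \<nu>t) \<nu> \<nu>t \<sigma> p f >
         ennreal (k \<alpha> \<rho> \<gamma> \<sigma>) * fun_norm p (\<Phi>t \<alpha> \<rho> \<gamma> \<delta> \<mu> \<nu> n0 \<sigma> p) f \<and>
       lhs3 (H \<alpha> \<rho> \<gamma> \<delta> \<mu> \<nu> \<nu>t) (\<theta> \<alpha> \<rho> \<gamma> \<delta> \<mu> \<nu> n0 \<sigma>) \<mu> \<delta> \<sigma> q a >
         ennreal (k \<alpha> \<rho> \<gamma> \<sigma>) * seq_norm q (\<Psi>t \<nu> \<nu>t \<sigma> q) a)
   \<and> (\<forall>K > k \<alpha> \<rho> \<gamma> \<sigma>.
       \<not> (\<forall>f a. admissible \<delta> \<mu> \<nu> \<nu>t \<sigma> p q f a \<longrightarrow>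
           lhs1 (H \<alpha> \<rho> \<gamma> \<delta> \<mu> \<nu> \<nu>t) f a >
             ennreal K * fun_norm p (\<Phi>t \<alpha> \<rho> \<gamma> \<delta> \<mu> \<nu> n0 \<sigma> p) f * seq_norm q (\<Psi>t \<nu> \<nu>t \<sigma> q) a) \<and>
       \<not> (\<forall>f a. admissible \<delta> \<mu> \<nu> \<nu>t \<sigma> p q f a \<longrightarrow>
           lhs2 (H \<alpha> \<rho> \<gamma> \<delta> \<mu> \<nu> \<nu>t) \<nu> \<nu>t \<sigma> p f >
             ennreal K * fun_norm p (\<Phi>t \<alpha> \<rho> \<gamma> \<delta> \<mu> \<nu> n0 \<sigma> p) f) \<and>
       \<not> (\<forall>f a. admissible \<delta> \<mu> \<nu> \<nu>t \<sigma> p q f a \<longrightarrow>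
           lhs3 (H \<alpha> \<rho> \<gamma> \<delta> \<mu> \<nu> \<nu>t) (\<theta> \<alpha> \<rho> \<gamma> \<delta> \<mu> \<nu> n0 \<sigma>) \<mu> \<delta> \<sigma> q a >
             ennreal K * seq_norm q (\<Psi>t \<nu> \<nu>t \<sigma> q) a))"
proof -
  interpret half_discrete_reverse \<alpha> \<rho> \<gamma> \<sigma> \<delta> p q \<mu> \<nu> \<nu>t n0
    using assms by unfold_locales auto
  have ineq: "ennreal (kk \<sigma>) * fun_norm p Pt f < lhs2 h \<nu> \<nu>t \<sigma> p f"
    "ennreal (kk \<sigma>) * seq_norm q Ps a < lhs3 h th \<mu> \<delta> \<sigma> q a"
    "ennreal (kk \<sigma>) * fun_norm p Pt f * seq_norm q Ps a < lhs1 h f a"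
    if "admissible \<delta> \<mu> \<nu> \<nu>t \<sigma> p q f a" for f a
    using that lhs2_greater[of f] lhs3_greater[of a] bound2_imp_bound1[of f a "kk \<sigma>"]
    by (auto simp: admissible_iff)
  have best: "\<exists>f a. admissible \<delta> \<mu> \<nu> \<nu>t \<sigma> p q f a \<and>
      \<not> ennreal K * fun_norm p Pt f * seq_norm q Ps a < lhs1 h f a \<and>
      \<not> ennreal K * fun_norm p Pt f < lhs2 h \<nu> \<nu>t \<sigma> p f \<and>
      \<not> ennreal K * seq_norm q Ps a < lhs3 h th \<mu> \<delta> \<sigma> q a" if K: "K > kk \<sigma>" for K
  proof -
    obtain f a where fa: "adm_fun f" "adm_seq a" "lhs1 h f a \<le> ennreal K * fun_norm p Pt f * seq_norm q Ps a"
      using best_constant[OF K] .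
    then have "\<not> ennreal K * fun_norm p Pt f * seq_norm q Ps a < lhs1 h f a" by simp
    with fa show ?thesis
      using bound2_imp_bound1[OF fa(1,2)] bound3_imp_bound1[OF fa(1,2)] admissible_iff by blast
  qed
  show ?thesis
    using ineq best by blast
qed

end
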